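(* Let $\Omega\subset\mathbb{P}$ be a bounded admissible domain with edges $A_i$, $B_j$ ($f$-geodesic arcs) and $C_k$ ($f$-convex arcs), and suppose that $u_1$ and $u_2$ are Jenkins-Serrin solutions over $\Omega$. If $\{C_k\}\neq\varnothing$ and $u_1=u_2$ on every $C_k$, then $u_1=u_2$ in $\Omega$. If $\{C_k\}=\varnothing$, then $u_2-u_1$ is constant.
   Context: Setting. $S$ is either $\mathbb{R}$ or $\mathbb{S}^1$ with a Riemannian metric $\varphi^2(x)\,dx^2$, $\rho\colon S\to(0,\infty)$ is smooth, $M=S\times_\rho\mathbb{R}$ is the surface with metric $\varphi^2(x)dx^2+\rho^2(x)ds^2$, assumed complete, and $g_0=\varphi^2(x)dx^2+\rho^2(x)ds^2+dt^2$ is the product metric on $M\times\mathbb{R}$. $\mathbb{P}=S\times\mathbb{R}$ has coordinates $(x,t)$, so $M\times\mathbb{R}=\mathbb{P}\times\mathbb{R}$ with coordinates $((x,t),s)$. Fix $c\in\mathbb{R}$. Ilmanen's metric is $g_c=e^{ct}g_0$, its restriction to $\mathbb{P}=\{s=0\}$ is $h_c=e^{ct}(\varphi^2(x)dx^2+dt^2)$, and $f(x,t)=e^{ct/2}\rho(x)$. Unless otherwise stated, gradient and divergence on $\mathbb{P}$ are with respect to $h_c$. Solutions. For $\Omega\subset\mathbb{P}$ a domain, a solution in $\Omega$ is a smooth function $u\colon\Omega\to\mathbb{R}$ with $\mathrm{div}_{\mathbb{P}}\big(f^2\,\nabla u/W\big)=0$ in $\Omega$, where $W=\sqrt{1+f^2h_c(\nabla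 u,\nabla u)}$. Curves. The $f$-curvature of a curve $\gamma$ in $\mathbb{P}$ with respect to a unit normal $N$ is ${\rm k}_f[\gamma]={\rm k}_{h_c}[\gamma]-h_c(\nabla f/f,N)$, where ${\rm k}_{h_c}[\gamma]$ is the geodesic curvature in $(\mathbb{P},h_c)$ with respect to $N$. A curve in $\mathbb{P}$ is an $f$-geodesic if (suitably parametrized) it is a geodesic of $(\mathbb{P},f^2h_c)$, equivalently ${\rm k}_f\equiv0$. An arc of $\partial\Omega$ is $f$-convex if ${\rm k}_f\ge0$ with respect to the inner unit normal. Admissible domain: a precompact domain $\Omega\subset\mathbb{P}$ whose boundary is a union of finitely many (open) $f$-geodesic arcs $A_i$, $B_j$, (open) $f$-convex arcs $C_k$, and the endpoints of these arcs, such that no two arcs $A_i$ and no two arcs $B_j$ have a common endpoint. Any of the families may be empty. Jenkins-Serrin solution over $\Omega$: a solution $u$ in $\Omega$ which extends continuously (with finite values) to each $C_k$, with $u\to+\infty$ on $A_i$ for all $i$, and $u\to-\infty$ on $B_j$ for all $j$. *)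

theory Defs
  imports "HOL-Analysis.Analysis"
begin

section \<open>Functions of class \<open>C\<^sup>k\<close> on open sets\<close>

primrec C_on :: "nat \<Rightarrow> ('a::euclidean_space \<Rightarrow> 'b::real_normed_vector) \<Rightarrow> 'a set \<Rightarrow> bool" where
  "C_on 0 F U \<longleftrightarrow> continuous_on U F"
| "C_on (Suc k) F U \<longleftrightarrow>
     (\<forall>x\<in>U. F differentiable (at x)) \<and>
     (\<forall>b\<in>Basis. C_on k (\<lambda>x. frechet_derivative F (at x) b) U)"

definition smooth :: "('a::euclidean_space \<Rightarrow> 'b::real_normed_vector) \<Rightarrow> 'a set \<Rightarrow> bool" where
  "smooth F U \<longleftrightarrow> (\<forall>k. C_on k F U)"


section \<open>Riemannian metrics in coordinates\<close>

text \<open>A metric on a coordinate domain is given as \<open>G p v w\<close>: the inner product at \<open>p\<close> of the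
  tangent vectors \<open>v\<close> and \<open>w\<close>.\<close>

type_synonym 'a riem = "'a \<Rightarrow> 'a \<Rightarrow> 'a \<Rightarrow> real"

definition grad :: "('a::euclidean_space) riem \<Rightarrow> ('a \<Rightarrow> real) \<Rightarrow> 'a \<Rightarrow> 'a" where
  "grad G u p = (THE y. \<forall>z. G p y z = frechet_derivative u (at p) z)"

text \<open>The bilinear map \<open>(v, w) \<mapsto> \<Sum> \<Gamma>\<^sup>k\<^sub>i\<^sub>j v\<^sup>i w\<^sup>j e\<^sub>k\<close> of the Levi-Civita connection, characterised by the
  Koszul formula for constant coordinate fields.\<close>

definition christoffel :: "('a::euclidean_space) riem \<Rightarrow> 'a \<Rightarrow> 'a \<Rightarrow> 'a \<Rightarrow> 'a" where
  "christoffel G p v w = (THE y. \<forall>z. G p y z =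
      (frechet_derivative (\<lambda>q. G q w z) (at p) v
     + frechet_derivative (\<lambda>q. G q v z) (at p) w
     - frechet_derivative (\<lambda>q. G q v w) (at p) z) / 2)"

definition cov_deriv :: "('a::euclidean_space) riem \<Rightarrow> ('a \<Rightarrow> 'a) \<Rightarrow> 'a \<Rightarrow> 'a \<Rightarrow> 'a" where
  "cov_deriv G X p v = frechet_derivative X (at p) v + christoffel G p v (X p)"

text \<open>The divergence is the trace of the endomorphism \<open>v \<mapsto> \<nabla>\<^sub>v X\<close>; a trace may be computed in any
  basis, so the coordinate basis is used although it is not \<open>G\<close>-orthonormal.\<close>

definition diverg :: "('a::euclidean_space) riem \<Rightarrow> ('a \<Rightarrow> 'a) \<Rightarrow> 'a \<Rightarrow> real" where
  "diverg G X p = (\<Sum>b\<in>Basis. cov_deriv G X p b \<bullet> b)"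

definition velocity :: "(real \<Rightarrow> 'a::euclidean_space) \<Rightarrow> real \<Rightarrow> 'a" where
  "velocity \<gamma> \<tau> = vector_derivative \<gamma> (at \<tau>)"

definition speed :: "('a::euclidean_space) riem \<Rightarrow> (real \<Rightarrow> 'a) \<Rightarrow> real \<Rightarrow> real" where
  "speed G \<gamma> \<tau> = sqrt (G (\<gamma> \<tau>) (velocity \<gamma> \<tau>) (velocity \<gamma> \<tau>))"

definition cov_along ::
  "('a::euclidean_space) riem \<Rightarrow> (real \<Rightarrow> 'a) \<Rightarrow> (real \<Rightarrow> 'a) \<Rightarrow> real \<Rightarrow> 'a" where
  "cov_along G \<gamma> V \<tau> = vector_derivative V (at \<tau>) + christoffel G (\<gamma> \<tau>) (velocity \<gamma> \<tau>) (V \<tau>)"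

definition geodesic_on :: "('a::euclidean_space) riem \<Rightarrow> (real \<Rightarrow> 'a) \<Rightarrow> real set \<Rightarrow> bool" where
  "geodesic_on G \<gamma> J \<longleftrightarrow> C_on 2 \<gamma> J \<and> (\<forall>\<tau>\<in>J. cov_along G \<gamma> (velocity \<gamma>) \<tau> = 0)"

text \<open>\<open>geod_curv G \<gamma> \<tau> N = G (\<nabla>\<^sub>T T) N\<close> with \<open>T\<close> the unit tangent; the division by the speed makes
  this independent of the parametrization.\<close>

definition geod_curv :: "('a::euclidean_space) riem \<Rightarrow> (real \<Rightarrow> 'a) \<Rightarrow> real \<Rightarrow> 'a \<Rightarrow> real" where
  "geod_curv G \<gamma> \<tau> N =
     G (\<gamma> \<tau>) (cov_along G \<gamma> (\<lambda>\<sigma>. velocity \<gamma> \<sigma> /\<^sub>R speed G \<gamma> \<sigma>) \<tau> /\<^sub>R speed G \<gamma> \<tau>) N"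


section \<open>The surface \<open>S \<times> \<real>\<close>\<close>

text \<open>\<open>S\<close> is realised in the complex plane, as the real axis or as the unit circle, and
  \<open>base_pt b\<close> parametrizes it by the coordinate \<open>x\<close>. The local diffeomorphism \<open>pt b\<close> of the
  plane onto \<open>S \<times> \<real>\<close> (a bijection for \<open>Line\<close>, the universal covering for \<open>Circle\<close>) provides the
  coordinates in which all differential-geometric notions are expressed; functions on subsets of
  \<open>S \<times> \<real>\<close> are composed with \<open>pt b\<close>, and curves are given by lifts to the coordinate plane.\<close>

datatype base_curve = Line | Circle

primrec base_pt :: "base_curve \<Rightarrow> real \<Rightarrow> complex" where
  "base_pt Line x = of_real x"
| "base_pt Circle x = cis x"

definition base_set :: "base_curve \<Rightarrow> complex set" where
  "base_set b = range (base_pt b)"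

definition surf :: "base_curve \<Rightarrow> (complex \<times> real) set" where
  "surf b = base_set b \<times> UNIV"

definition pt :: "base_curve \<Rightarrow> real \<times> real \<Rightarrow> complex \<times> real" where
  "pt b p = (base_pt b (fst p), snd p)"

definition smooth_on_base :: "base_curve \<Rightarrow> (complex \<Rightarrow> real) \<Rightarrow> bool" where
  "smooth_on_base b F \<longleftrightarrow> smooth (F \<circ> base_pt b) UNIV"

text \<open>Completeness of a metric on \<open>S \<times> \<real>\<close>, in the sense of its Riemannian distance. Every curve in
  \<open>S \<times> \<real>\<close> lifts to the coordinate plane, so the infimum is over all \<open>C\<^sup>1\<close> curves from \<open>P\<close> to \<open>Q\<close>.
  The value 0 off the surface is only there because the locale \<open>Metric_space\<close> asks for a distance
  that is nonnegative and symmetric on the whole type.\<close>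

definition curve_length :: "(real \<times> real) riem \<Rightarrow> (real \<Rightarrow> real \<times> real) \<Rightarrow> real" where
  "curve_length G \<gamma> = integral {0..1} (speed G \<gamma>)"

definition riem_dist ::
  "base_curve \<Rightarrow> (real \<times> real) riem \<Rightarrow> complex \<times> real \<Rightarrow> complex \<times> real \<Rightarrow> real" where
  "riem_dist b G P Q = (if P \<in> surf b \<and> Q \<in> surf b
     then Inf {curve_length G \<gamma> | \<gamma>.
       \<gamma> C1_differentiable_on {0..1} \<and> pt b (\<gamma> 0) = P \<and> pt b (\<gamma> 1) = Q}
     else 0)"

definition complete_riem :: "base_curve \<Rightarrow> (real \<times> real) riem \<Rightarrow> bool" where
  "complete_riem b G \<longleftrightarrow> Metric_space.mcomplete (surf b) (riem_dist b G)"

text \<open>\<open>\<phi>\<^sup>2 dx\<^sup>2 + \<rho>\<^sup>2 ds\<^sup>2\<close> on \<open>M\<close>, in the coordinates \<open>(x, s)\<close>.\<close>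

definition warped_metric ::
  "base_curve \<Rightarrow> (complex \<Rightarrow> real) \<Rightarrow> (complex \<Rightarrow> real) \<Rightarrow> (real \<times> real) riem" where
  "warped_metric b \<phi> \<rho> p v w =
     (\<phi> (base_pt b (fst p)))\<^sup>2 * fst v * fst w + (\<rho> (base_pt b (fst p)))\<^sup>2 * snd v * snd w"

text \<open>\<open>h\<^sub>c = e\<^sup>c\<^sup>t (\<phi>\<^sup>2 dx\<^sup>2 + dt\<^sup>2)\<close> and \<open>f = e\<^sup>c\<^sup>t\<^sup>/\<^sup>2 \<rho>\<close>, in the coordinates \<open>(x, t)\<close>.\<close>

definition hmet :: "base_curve \<Rightarrow> real \<Rightarrow> (complex \<Rightarrow> real) \<Rightarrow> (real \<times> real) riem" where
  "hmet b c \<phi> p v w =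
     exp (c * snd p) * ((\<phi> (base_pt b (fst p)))\<^sup>2 * fst v * fst w + snd v * snd w)"

definition fweight :: "base_curve \<Rightarrow> real \<Rightarrow> (complex \<Rightarrow> real) \<Rightarrow> real \<times> real \<Rightarrow> real" where
  "fweight b c \<rho> p = exp (c * snd p / 2) * \<rho> (base_pt b (fst p))"


section \<open>Solutions\<close>

definition Wfun ::
  "base_curve \<Rightarrow> real \<Rightarrow> (complex \<Rightarrow> real) \<Rightarrow> (complex \<Rightarrow> real) \<Rightarrow>
   (real \<times> real \<Rightarrow> real) \<Rightarrow> real \<times> real \<Rightarrow> real" where
  "Wfun b c \<phi> \<rho> v p =
     sqrt (1 + (fweight b c \<rho> p)\<^sup>2 *
       hmet b c \<phi> p (grad (hmet b c \<phi>) v p) (grad (hmet b c \<phi>) v p))"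

definition is_solution ::
  "base_curve \<Rightarrow> real \<Rightarrow> (complex \<Rightarrow> real) \<Rightarrow> (complex \<Rightarrow> real) \<Rightarrow>
   (complex \<times> real) set \<Rightarrow> (complex \<times> real \<Rightarrow> real) \<Rightarrow> bool" where
  "is_solution b c \<phi> \<rho> \<Omega> u \<longleftrightarrow>
     smooth (u \<circ> pt b) (pt b -` \<Omega>) \<and>
     (\<forall>p \<in> pt b -` \<Omega>.
        diverg (hmet b c \<phi>)
          (\<lambda>q. ((fweight b c \<rho> q)\<^sup>2 / Wfun b c \<phi> \<rho> (u \<circ> pt b) q) *\<^sub>R
                 grad (hmet b c \<phi>) (u \<circ> pt b) q) p = 0)"


section \<open>Arcs\<close>

text \<open>An open arc is the image of the open unit interval. Only continuity is required at the end
  points, which may coincide (a closed curve with one marked point).\<close>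

definition is_arc :: "base_curve \<Rightarrow> (real \<Rightarrow> real \<times> real) \<Rightarrow> bool" where
  "is_arc b \<gamma> \<longleftrightarrow> path \<gamma> \<and> simple_path (pt b \<circ> \<gamma>) \<and> C_on 2 \<gamma> {0<..<1} \<and>
     (\<forall>\<tau>\<in>{0<..<1}. velocity \<gamma> \<tau> \<noteq> 0)"

definition open_arc :: "base_curve \<Rightarrow> (real \<Rightarrow> real \<times> real) \<Rightarrow> (complex \<times> real) set" where
  "open_arc b \<gamma> = (pt b \<circ> \<gamma>) ` {0<..<1}"

definition arc_ends :: "base_curve \<Rightarrow> (real \<Rightarrow> real \<times> real) \<Rightarrow> (complex \<times> real) set" where
  "arc_ends b \<gamma> = {pt b (\<gamma> 0), pt b (\<gamma> 1)}"

definition f_geodesic_arc ::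
  "base_curve \<Rightarrow> real \<Rightarrow> (complex \<Rightarrow> real) \<Rightarrow> (complex \<Rightarrow> real) \<Rightarrow>
   (real \<Rightarrow> real \<times> real) \<Rightarrow> bool" where
  "f_geodesic_arc b c \<phi> \<rho> \<gamma> \<longleftrightarrow> is_arc b \<gamma> \<and>
     (\<exists>J \<theta>. open J \<and> connected J \<and> C_on 2 \<theta> J \<and> (\<forall>\<sigma>\<in>J. deriv \<theta> \<sigma> \<noteq> 0) \<and>
        \<theta> ` J = {0<..<1} \<and>
        geodesic_on (\<lambda>p v w. (fweight b c \<rho> p)\<^sup>2 * hmet b c \<phi> p v w) (\<gamma> \<circ> \<theta>) J)"

definition f_curv ::
  "base_curve \<Rightarrow> real \<Rightarrow> (complex \<Rightarrow> real) \<Rightarrow> (complex \<Rightarrow> real) \<Rightarrow>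
   (real \<Rightarrow> real \<times> real) \<Rightarrow> real \<Rightarrow> real \<times> real \<Rightarrow> real" where
  "f_curv b c \<phi> \<rho> \<gamma> \<tau> N = geod_curv (hmet b c \<phi>) \<gamma> \<tau> N -
     hmet b c \<phi> (\<gamma> \<tau>) (grad (hmet b c \<phi>) (fweight b c \<rho>) (\<gamma> \<tau>) /\<^sub>R fweight b c \<rho> (\<gamma> \<tau>)) N"

definition inner_unit_normal ::
  "base_curve \<Rightarrow> real \<Rightarrow> (complex \<Rightarrow> real) \<Rightarrow> (complex \<times> real) set \<Rightarrow>
   (real \<Rightarrow> real \<times> real) \<Rightarrow> real \<Rightarrow> real \<times> real \<Rightarrow> bool" where
  "inner_unit_normal b c \<phi> \<Omega> \<gamma> \<tau> N \<longleftrightarrow>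
     hmet b c \<phi> (\<gamma> \<tau>) N N = 1 \<and> hmet b c \<phi> (\<gamma> \<tau>) N (velocity \<gamma> \<tau>) = 0 \<and>
     (\<exists>\<delta>>0. \<forall>\<epsilon>\<in>{0<..<\<delta>}. pt b (\<gamma> \<tau> + \<epsilon> *\<^sub>R N) \<in> \<Omega>)"

text \<open>In an admissible domain, as defined below, an open boundary arc is relatively open in the
  boundary, so that an inner unit normal always exists; there are two only if \<open>\<Omega>\<close> lies on both
  sides of the arc.\<close>

definition f_convex_arc ::
  "base_curve \<Rightarrow> real \<Rightarrow> (complex \<Rightarrow> real) \<Rightarrow> (complex \<Rightarrow> real) \<Rightarrow> (complex \<times> real) set \<Rightarrow>
   (real \<Rightarrow> real \<times> real) \<Rightarrow> bool" where
  "f_convex_arc b c \<phi> \<rho> \<Omega> \<gamma> \<longleftrightarrow> is_arc b \<gamma> \<and>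
     (\<forall>\<tau>\<in>{0<..<1}. \<forall>N. inner_unit_normal b c \<phi> \<Omega> \<gamma> \<tau> N \<longrightarrow> f_curv b c \<phi> \<rho> \<gamma> \<tau> N \<ge> 0)"


section \<open>Admissible domains and Jenkins-Serrin solutions\<close>

text \<open>\<open>surf b\<close> is closed in the ambient space, so \<open>compact (closure \<Omega>)\<close> says that \<open>\<Omega>\<close> is precompact
  in \<open>surf b\<close>.\<close>

definition admissible_domain ::
  "base_curve \<Rightarrow> real \<Rightarrow> (complex \<Rightarrow> real) \<Rightarrow> (complex \<Rightarrow> real) \<Rightarrow> (complex \<times> real) set \<Rightarrow>
   (real \<Rightarrow> real \<times> real) set \<Rightarrow> (real \<Rightarrow> real \<times> real) set \<Rightarrow> (real \<Rightarrow> real \<times> real) set \<Rightarrow> bool" where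
  "admissible_domain b c \<phi> \<rho> \<Omega> \<A> \<B> \<C> \<longleftrightarrow>
     openin (top_of_set (surf b)) \<Omega> \<and> connected \<Omega> \<and> \<Omega> \<noteq> {} \<and> compact (closure \<Omega>) \<and>
     finite \<A> \<and> finite \<B> \<and> finite \<C> \<and> \<A> \<inter> \<B> = {} \<and> \<A> \<inter> \<C> = {} \<and> \<B> \<inter> \<C> = {} \<and>
     (\<forall>\<gamma>\<in>\<A> \<union> \<B>. f_geodesic_arc b c \<phi> \<rho> \<gamma>) \<and>
     (\<forall>\<gamma>\<in>\<C>. f_convex_arc b c \<phi> \<rho> \<Omega> \<gamma>) \<and>
     (\<forall>\<gamma>\<in>\<A> \<union> \<B> \<union> \<C>. \<forall>\<eta>\<in>\<A> \<union> \<B> \<union> \<C>. \<gamma> \<noteq> \<eta> \<longrightarrow>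
        open_arc b \<gamma> \<inter> (open_arc b \<eta> \<union> arc_ends b \<eta>) = {}) \<and>
     top_of_set (surf b) frontier_of \<Omega> = (\<Union>\<gamma>\<in>\<A> \<union> \<B> \<union> \<C>. open_arc b \<gamma> \<union> arc_ends b \<gamma>) \<and>
     (\<forall>\<gamma>\<in>\<A>. \<forall>\<eta>\<in>\<A>. \<gamma> \<noteq> \<eta> \<longrightarrow> arc_ends b \<gamma> \<inter> arc_ends b \<eta> = {}) \<and>
     (\<forall>\<gamma>\<in>\<B>. \<forall>\<eta>\<in>\<B>. \<gamma> \<noteq> \<eta> \<longrightarrow> arc_ends b \<gamma> \<inter> arc_ends b \<eta> = {})"

definition extends_continuously_to ::
  "('a::topological_space \<Rightarrow> 'b::topological_space) \<Rightarrow> 'a set \<Rightarrow> 'a set \<Rightarrow> bool" where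
  "extends_continuously_to u \<Omega> E \<longleftrightarrow> (\<exists>v. continuous_on (\<Omega> \<union> E) v \<and> (\<forall>p\<in>\<Omega>. v p = u p))"

definition jenkins_serrin_solution ::
  "base_curve \<Rightarrow> real \<Rightarrow> (complex \<Rightarrow> real) \<Rightarrow> (complex \<Rightarrow> real) \<Rightarrow> (complex \<times> real) set \<Rightarrow>
   (real \<Rightarrow> real \<times> real) set \<Rightarrow> (real \<Rightarrow> real \<times> real) set \<Rightarrow> (real \<Rightarrow> real \<times> real) set \<Rightarrow>
   (complex \<times> real \<Rightarrow> real) \<Rightarrow> bool" where
  "jenkins_serrin_solution b c \<phi> \<rho> \<Omega> \<A> \<B> \<C> u \<longleftrightarrow>
     is_solution b c \<phi> \<rho> \<Omega> u \<and>
     (\<forall>\<gamma>\<in>\<C>. extends_continuously_to u \<Omega> (open_arc b \<gamma>)) \<and>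
     (\<forall>\<gamma>\<in>\<A>. \<forall>p\<in>open_arc b \<gamma>. filterlim u at_top (at p within \<Omega>)) \<and>
     (\<forall>\<gamma>\<in>\<B>. \<forall>p\<in>open_arc b \<gamma>. filterlim u at_bot (at p within \<Omega>))"

text \<open>The value of the continuous extension of \<open>u\<close> at a boundary point.\<close>

definition boundary_value ::
  "(complex \<times> real \<Rightarrow> real) \<Rightarrow> (complex \<times> real) set \<Rightarrow> complex \<times> real \<Rightarrow> real" where
  "boundary_value u \<Omega> p = Lim (at p within \<Omega>) u"

end

theory Submission
  imports Defs
begin

text \<open>In the coordinates \<open>(x, t)\<close> the equation is a conservation law for \<open>\<mu> X\<close>, where \<open>\<mu> = e\<^sup>c\<^sup>t \<bar>\<phi>\<bar>\<close> and,
  with \<open>\<xi> = (\<rho> u\<^sub>x / \<phi>, \<rho> u\<^sub>t)\<close> and \<open>W = \<surd>(1 + \<bar>\<xi>\<bar>\<^sup>2)\<close>, the vector field \<open>X\<close> pairs with the differential of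
  another function as \<open>\<xi> \<bullet> \<xi>' / W\<close>. Put \<open>w = u1 - u2\<close> and \<open>Z = X1 - X2\<close>; then \<open>dw(Z) \<ge> 0\<close>, with equality only
  where \<open>dw = 0\<close>. The weak form \<open>\<integral> \<mu> d\<zeta>(Z) = 0\<close> is applied to
  \<open>\<zeta> = T(w) g(u2) h(u1) \<psi>\<close>, where \<open>T\<close> is increasing and vanishes on \<open>w \<le> \<epsilon>\<close> (hence near the arcs \<open>C\<close>), \<open>g\<close>
  decreases from 1 to 0 on \<open>[K, 2K]\<close> (so \<open>\<zeta>\<close> vanishes near the arcs \<open>A\<close>), \<open>h\<close> increases from 0 to 1 on
  \<open>[-2K, -K]\<close> (so \<open>\<zeta>\<close> vanishes near the arcs \<open>B\<close>), and \<open>\<psi>\<close> removes the vertices, which have zero capacity.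

  The flux of a solution that blows up need not be computed: since \<open>du2(Z) \<le> 1\<close> and \<open>du1(Z) \<ge> -1\<close>, the
  terms with \<open>g'\<close> and \<open>h'\<close> are bounded in the useful direction by \<open>\<bar>g'\<bar> + \<bar>h'\<bar> = O(1/K)\<close>. Letting
  \<open>K \<rightarrow> \<infinity>\<close> gives \<open>dw = 0\<close> wherever \<open>w > 0\<close>, so \<open>w\<close> is either nonpositive or a positive constant, and a
  positive constant is incompatible with \<open>w = 0\<close> on an arc \<open>C\<close>.\<close>

section \<open>Continuously differentiable functions of two variables\<close>

text \<open>Continuity of the derivative is asked for in every direction \<open>v\<close>, not only
  along \<open>Basis\<close> as in \<open>C_on\<close>; in this form sums, products and compositions
  are handled direction by direction. \<open>C1_smooth\<close> passes from \<open>smooth\<close> to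
  \<open>C1\<close>.\<close>

definition C1 :: "(real \<times> real \<Rightarrow> real) \<Rightarrow> (real \<times> real) set \<Rightarrow> bool" where
  "C1 F U \<longleftrightarrow> (\<forall>p\<in>U. F differentiable (at p)) \<and>
     (\<forall>v. continuous_on U (\<lambda>p. frechet_derivative F (at p) v))"

lemma C1I:
  assumes "\<And>p. p \<in> U \<Longrightarrow> (F has_derivative F' p) (at p)"
    and "\<And>v. continuous_on U (\<lambda>p. F' p v)"
  shows "C1 F U"
proof -
  have "frechet_derivative F (at p) = F' p" if "p \<in> U" for p
    using frechet_derivative_at[OF assms(1)[OF that]] by simp
  then have "continuous_on U (\<lambda>p. frechet_derivative F (at p) v)" for v
    using assms(2)[of v] continuous_on_cong[OF refl] by (smt (verit, best))
  moreover have "F differentiable (at p)" if "p \<in> U" for p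
    using assms(1)[OF that] by (rule differentiableI)
  ultimately show ?thesis
    by (simp add: C1_def)
qed

lemma C1_has_derivative:
  "C1 F U \<Longrightarrow> p \<in> U \<Longrightarrow> (F has_derivative frechet_derivative F (at p)) (at p)"
  by (auto simp: C1_def frechet_derivative_works)

lemma C1_continuous_deriv: "C1 F U \<Longrightarrow> continuous_on U (\<lambda>p. frechet_derivative F (at p) v)"
  unfolding C1_def by blast

lemma C1_continuous: "C1 F U \<Longrightarrow> continuous_on U F"
  by (meson C1_def differentiable_at_imp_differentiable_on differentiable_imp_continuous_on)

lemma C1_subset: "C1 F U \<Longrightarrow> V \<subseteq> U \<Longrightarrow> C1 F V"
  unfolding C1_def by (meson continuous_on_subset subsetD)

lemma C1_const: "C1 (\<lambda>_. k) U"
  by (rule C1I[where F' = "\<lambda>_ _. 0"]) auto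

lemma C1_fst: "C1 fst U"
  by (rule C1I[where F' = "\<lambda>_. fst"]) (auto intro!: derivative_eq_intros)

lemma C1_snd: "C1 snd U"
  by (rule C1I[where F' = "\<lambda>_. snd"]) (auto intro!: derivative_eq_intros)

lemma C1_add: "C1 F U \<Longrightarrow> C1 G U \<Longrightarrow> C1 (\<lambda>p. F p + G p) U"
  by (rule C1I[OF has_derivative_add[OF C1_has_derivative C1_has_derivative]])
    (assumption | intro continuous_intros C1_continuous_deriv)+

lemma C1_diff: "C1 F U \<Longrightarrow> C1 G U \<Longrightarrow> C1 (\<lambda>p. F p - G p) U"
  by (rule C1I[OF has_derivative_diff[OF C1_has_derivative C1_has_derivative]])
    (assumption | intro continuous_intros C1_continuous_deriv)+

lemma C1_mult: "C1 F U \<Longrightarrow> C1 G U \<Longrightarrow> C1 (\<lambda>p. F p * G p) U"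
  by (rule C1I[OF has_derivative_mult[OF C1_has_derivative C1_has_derivative]])
    (assumption | intro continuous_intros C1_continuous_deriv C1_continuous)+

lemma C1_compose:
  assumes F: "C1 F U" and g: "\<And>p. p \<in> U \<Longrightarrow> (g has_real_derivative g' (F p)) (at (F p))"
    and cg: "continuous_on (F ` U) g'"
  shows "C1 (\<lambda>p. g (F p)) U"
proof (rule C1I)
  fix p assume p: "p \<in> U"
  show "((\<lambda>p. g (F p)) has_derivative (\<lambda>v. frechet_derivative F (at p) v * g' (F p))) (at p)"
    using has_derivative_compose[OF C1_has_derivative[OF F p], of g "(*) (g' (F p))"] g[OF p]
    by (simp add: has_field_derivative_def mult.commute)
next
  show "continuous_on U (\<lambda>p. frechet_derivative F (at p) v * g' (F p))" for v
    using F by (intro continuous_intros continuous_on_compose2[OF cg] C1_continuous C1_continuous_deriv) auto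
qed

lemma C1_inverse: "C1 F U \<Longrightarrow> (\<And>p. p \<in> U \<Longrightarrow> F p \<noteq> 0) \<Longrightarrow> C1 (\<lambda>p. inverse (F p)) U"
  by (rule C1_compose[where g' = "\<lambda>x. - (inverse x * inverse x)"])
    (auto intro!: continuous_intros DERIV_inverse' derivative_eq_intros)

lemma C1_divide: "C1 F U \<Longrightarrow> C1 G U \<Longrightarrow> (\<And>p. p \<in> U \<Longrightarrow> G p \<noteq> 0) \<Longrightarrow> C1 (\<lambda>p. F p / G p) U"
  by (simp add: divide_inverse C1_mult C1_inverse)

lemma C1_power2: "C1 F U \<Longrightarrow> C1 (\<lambda>p. (F p)\<^sup>2) U"
  by (simp add: power2_eq_square C1_mult)

lemma C1_sqrt: "C1 F U \<Longrightarrow> (\<And>p. p \<in> U \<Longrightarrow> F p > 0) \<Longrightarrow> C1 (\<lambda>p. sqrt (F p)) U"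
  by (rule C1_compose[where g' = "\<lambda>x. inverse (sqrt x) / 2"])
    (force intro!: continuous_intros DERIV_real_sqrt)+

lemma C1_smooth: "smooth F U \<Longrightarrow> C1 F U"
  and C1_smooth_deriv: "smooth F U \<Longrightarrow> e \<in> Basis \<Longrightarrow> C1 (\<lambda>p. frechet_derivative F (at p) e) U"
proof -
  have *: "C1 F U" if F: "C_on (Suc 0) F U" for F :: "real \<times> real \<Rightarrow> real"
  proof -
    have d: "(F has_derivative frechet_derivative F (at p)) (at p)" if "p \<in> U" for p
      using F that by (auto simp: frechet_derivative_works)
    have "frechet_derivative F (at p) v = (\<Sum>e\<in>Basis. (v \<bullet> e) * frechet_derivative F (at p) e)"
      if "p \<in> U" for p v
      using Linear_Algebra.linear_componentwise[OF has_derivative_linear[OF d[OF that]], of v 1] by simp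
    moreover have "continuous_on U (\<lambda>p. \<Sum>e\<in>Basis. (v \<bullet> e) * frechet_derivative F (at p) e)" for v
      using F by (auto intro!: continuous_intros)
    ultimately show ?thesis
      by (intro C1I[OF d]) (simp_all cong: continuous_on_cong)
  qed
  show "smooth F U \<Longrightarrow> C1 F U"
    by (intro *) (auto simp only: smooth_def)
  assume "smooth F U" "e \<in> Basis"
  then have "C_on (Suc (Suc 0)) F U" by (auto simp only: smooth_def)
  then show "C1 (\<lambda>p. frechet_derivative F (at p) e) U"
    using \<open>e \<in> Basis\<close> by (intro *) simp
qed

section \<open>Derivative rules, extension by zero, and the divergence theorem on a box\<close>

lemma frechet_derivative_prod:
  assumes "(F :: real \<times> real \<Rightarrow> real) differentiable (at p)"
  shows "frechet_derivative F (at p) v =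
    fst v * frechet_derivative F (at p) (1, 0) + snd v * frechet_derivative F (at p) (0, 1)"
proof -
  interpret linear "frechet_derivative F (at p)"
    using assms linear_frechet_derivative by auto
  have "v = fst v *\<^sub>R (1, 0) + snd v *\<^sub>R (0, 1)"
    by (simp add: prod_eq_iff)
  then show ?thesis
    by (metis add scale real_scaleR_def)
qed

lemma frechet_derivative_mult:
  fixes F G :: "real \<times> real \<Rightarrow> real"
  assumes "F differentiable (at p)" "G differentiable (at p)"
  shows "frechet_derivative (\<lambda>q. F q * G q) (at p) v =
    F p * frechet_derivative G (at p) v + frechet_derivative F (at p) v * G p"
  using frechet_derivative_at[OF has_derivative_mult[OF assms[THEN iffD1[OF frechet_derivative_works]]]]
  by (rule fun_cong[OF sym])

lemma frechet_derivative_diff: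
  fixes F G :: "real \<times> real \<Rightarrow> real"
  assumes "F differentiable (at p)" "G differentiable (at p)"
  shows "frechet_derivative (\<lambda>q. F q - G q) (at p) v =
    frechet_derivative F (at p) v - frechet_derivative G (at p) v"
  using frechet_derivative_at[OF has_derivative_diff[OF assms[THEN iffD1[OF frechet_derivative_works]]]]
  by (rule fun_cong[OF sym])

lemma frechet_derivative_comp_real:
  fixes F :: "real \<times> real \<Rightarrow> real"
  assumes "F differentiable (at p)" "(g has_real_derivative d) (at (F p))"
  shows "frechet_derivative (\<lambda>q. g (F q)) (at p) v = d * frechet_derivative F (at p) v"
proof -
  have "((\<lambda>q. g (F q)) has_derivative (\<lambda>v. d * frechet_derivative F (at p) v)) (at p)"
    using has_derivative_compose[of F "frechet_derivative F (at p)" p UNIV g "(*) d"] assms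
    by (simp add: frechet_derivative_works has_field_derivative_def)
  from frechet_derivative_at[OF this] show ?thesis by (rule fun_cong[OF sym])
qed

text \<open>Near every point the extension agrees either with \<open>F\<close> or with 0. Vanishing
  is demanded on \<open>N \<inter> U\<close> for points off \<open>U\<close>, so boundary points of
  \<open>U\<close> are covered. This turns a test function times a flux, given only over the domain,
  into a global field that can be integrated over a box.\<close>

lemma C1_extend_zero:
  assumes "open U" "C1 F U"
    and zero: "\<forall>p. p \<notin> U \<longrightarrow> (\<exists>N. open N \<and> p \<in> N \<and> (\<forall>q\<in>N \<inter> U. F q = 0))"
  defines "G \<equiv> \<lambda>p. if p \<in> U then F p else 0"
  shows "C1 G UNIV"
    and "p \<in> U \<Longrightarrow> frechet_derivative G (at p) = frechet_derivative F (at p)"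
    and "p \<notin> U \<Longrightarrow> frechet_derivative G (at p) = (\<lambda>_. 0)"
proof -
  have i: "(G has_derivative frechet_derivative F (at p)) (at p)" if "p \<in> U" for p
    by (rule has_derivative_transform_within_open[OF C1_has_derivative[OF \<open>C1 F U\<close> that] \<open>open U\<close> that])
      (simp add: G_def)
  have o': "(G has_derivative (\<lambda>_. 0)) (at q)" if "open N" "q \<in> N" "\<forall>q\<in>N \<inter> U. F q = 0" for q N
    by (rule has_derivative_transform_within_open[OF has_derivative_const[of 0] that(1,2)])
      (use that in \<open>auto simp: G_def\<close>)
  have i': "frechet_derivative G (at p) = frechet_derivative F (at p)" if "p \<in> U" for p
    using frechet_derivative_at[OF i[OF that]] by simp
  have o2: "frechet_derivative G (at p) = (\<lambda>_. 0)" if "open N" "p \<in> N" "\<forall>q\<in>N \<inter> U. F q = 0" for p N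
    using frechet_derivative_at[OF o'[OF that]] by simp
  show "p \<in> U \<Longrightarrow> frechet_derivative G (at p) = frechet_derivative F (at p)" by (rule i')
  show "frechet_derivative G (at p) = (\<lambda>_. 0)" if "p \<notin> U"
    using zero o2 that by blast
  have "isCont (\<lambda>p. frechet_derivative G (at p) v) p" for p v
  proof (cases "p \<in> U")
    case True
    have "continuous_on U (\<lambda>p. frechet_derivative G (at p) v)"
      using C1_continuous_deriv[OF \<open>C1 F U\<close>] i' by (auto cong: continuous_on_cong)
    then show ?thesis using \<open>open U\<close> True continuous_on_eq_continuous_at by blast
  next
    case False
    from zero this obtain N where N: "open N" "p \<in> N" "\<forall>q\<in>N \<inter> U. F q = 0" by blast
    then have "continuous_on N (\<lambda>p. frechet_derivative G (at p) v)"
      using o2 by (auto cong: continuous_on_cong)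
    then show ?thesis using N continuous_on_eq_continuous_at by blast
  qed
  moreover have "G differentiable (at p)" for p
    by (cases "p \<in> U") (use i o' zero in \<open>metis differentiableI\<close>)+
  ultimately show "C1 G UNIV"
    by (auto simp: C1_def continuous_at_imp_continuous_on)
qed

lemma C1_has_vector_derivative_fst:
  assumes "C1 F UNIV"
  shows "((\<lambda>x. F (x, t)) has_vector_derivative frechet_derivative F (at (x, t)) (1, 0)) (at x within S)"
proof -
  have "((\<lambda>x. (x, t)) has_derivative (\<lambda>h. (h, 0))) (at x within S)"
    by (auto intro!: derivative_eq_intros)
  from diff_chain_within[OF this has_derivative_at_withinI[OF C1_has_derivative[OF assms]]]
  have "((\<lambda>x. F (x, t)) has_derivative (\<lambda>h. frechet_derivative F (at (x, t)) (h, 0))) (at x within S)"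
    by (simp add: o_def)
  also have "(\<lambda>h. frechet_derivative F (at (x, t)) (h, 0)) = (\<lambda>h. h *\<^sub>R frechet_derivative F (at (x, t)) (1, 0))"
  proof
    show "frechet_derivative F (at (x, t)) (h, 0) = h *\<^sub>R frechet_derivative F (at (x, t)) (1, 0)" for h
      by (subst frechet_derivative_prod) (use assms in \<open>simp_all add: C1_def\<close>)
  qed
  finally show ?thesis by (simp add: has_vector_derivative_def)
qed

lemma C1_has_vector_derivative_snd:
  assumes "C1 F UNIV"
  shows "((\<lambda>t. F (x, t)) has_vector_derivative frechet_derivative F (at (x, t)) (0, 1)) (at t within S)"
proof -
  have "((\<lambda>t. (x, t)) has_derivative (\<lambda>h. (0, h))) (at t within S)"
    by (auto intro!: derivative_eq_intros)
  from diff_chain_within[OF this has_derivative_at_withinI[OF C1_has_derivative[OF assms]]]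
  have "((\<lambda>t. F (x, t)) has_derivative (\<lambda>h. frechet_derivative F (at (x, t)) (0, h))) (at t within S)"
    by (simp add: o_def)
  also have "(\<lambda>h. frechet_derivative F (at (x, t)) (0, h)) = (\<lambda>h. h *\<^sub>R frechet_derivative F (at (x, t)) (0, 1))"
  proof
    show "frechet_derivative F (at (x, t)) (0, h) = h *\<^sub>R frechet_derivative F (at (x, t)) (0, 1)" for h
      by (subst frechet_derivative_prod) (use assms in \<open>simp_all add: C1_def\<close>)
  qed
  finally show ?thesis by (simp add: has_vector_derivative_def)
qed

text \<open>Fubini and the fundamental theorem of calculus in each variable. Asking for equal values
  on opposite sides, rather than zero values, lets one statement serve both the line, where the
  field vanishes there, and the circle, where the box is one period.\<close>

lemma divergence_box:
  assumes P: "C1 P UNIV" and Q: "C1 Q UNIV" and "x1 \<le> x2" "t1 \<le> t2"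
    and "\<And>t. P (x1, t) = P (x2, t)" and "\<And>x. Q (x, t1) = Q (x, t2)"
  shows "integral (cbox (x1, t1) (x2, t2))
    (\<lambda>p. frechet_derivative P (at p) (1, 0) + frechet_derivative Q (at p) (0, 1)) = 0"
proof -
  let ?B = "cbox (x1, t1) (x2, t2)"
  let ?P = "\<lambda>p. frechet_derivative P (at p) (1, 0)" and ?Q = "\<lambda>p. frechet_derivative Q (at p) (0, 1)"
  have c: "continuous_on ?B ?P" "continuous_on ?B ?Q"
    by (rule continuous_on_subset[OF C1_continuous_deriv subset_UNIV], fact)+
  have "integral (cbox t1 t2) (\<lambda>t. ?Q (x, t)) = 0" for x
    using fundamental_theorem_of_calculus[OF \<open>t1 \<le> t2\<close> C1_has_vector_derivative_snd[OF Q, of x]] assms(6)[of x]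
    by (simp add: integral_unique)
  then have q: "integral ?B ?Q = 0"
    by (simp only: integral_prod_continuous[OF c(2)] integral_0)
  have "integral (cbox x1 x2) (\<lambda>x. ?P (x, t)) = 0" for t
    using fundamental_theorem_of_calculus[OF \<open>x1 \<le> x2\<close> C1_has_vector_derivative_fst[OF P, of t]] assms(5)[of t]
    by (simp add: integral_unique)
  \<comment> \<open>For \<open>P\<close> the integral in x has to be the inner one, hence the
    exchange of the order of integration.\<close>
  then have p: "integral ?B ?P = 0"
    using integral_swap_continuous[of x1 t1 x2 t2 "\<lambda>x t. ?P (x, t)"] c(1)
    by (simp only: integral_prod_continuous[OF c(1)] integral_0 case_prod_unfold prod.collapse)
  have "integral ?B (\<lambda>p. ?P p + ?Q p) = integral ?B ?P + integral ?B ?Q"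
    by (intro integral_add integrable_continuous c)
  then show ?thesis using p q by simp
qed

section \<open>A smooth step\<close>

text \<open>A tent on [0, 1] with peak 2 at 1/2 and total mass 1. Its antiderivative
  \<open>step\<close> is piecewise quadratic and only C1, which suffices because test functions are
  differentiated once.\<close>

definition step' :: "real \<Rightarrow> real" where
  "step' s = 4 * max 0 s - 8 * max 0 (s - 1/2) + 4 * max 0 (s - 1)"

definition step :: "real \<Rightarrow> real" where
  "step s = 2 * (max 0 s)\<^sup>2 - 4 * (max 0 (s - 1/2))\<^sup>2 + 2 * (max 0 (s - 1))\<^sup>2"

lemma DERIV_max_0_power2: "((\<lambda>s::real. (max 0 s)\<^sup>2) has_real_derivative 2 * max 0 s) (at s)"
proof (cases "s = 0")
  case True
  have "((\<lambda>h::real. (max 0 h)\<^sup>2 / h) \<longlongrightarrow> 0) (at 0)"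
  proof (rule Lim_null_comparison)
    show "\<forall>\<^sub>F h in at 0. norm ((max 0 h)\<^sup>2 / h) \<le> \<bar>h\<bar>"
      by (intro always_eventually) (auto simp: max_def power2_eq_square)
    show "((\<lambda>h::real. \<bar>h\<bar>) \<longlongrightarrow> 0) (at 0)" by (rule tendsto_eq_intros refl)+ simp
  qed
  then show ?thesis using True by (simp add: DERIV_def)
next
  case False
  then consider "s > 0" | "s < 0" by linarith
  then show ?thesis
  proof cases
    case 1
    show ?thesis
      by (rule has_field_derivative_transform_within_open[where f = "\<lambda>s. s\<^sup>2" and S = "{0<..}"])
        (use 1 in \<open>auto intro!: derivative_eq_intros\<close>)
  next
    case 2
    show ?thesis
      by (rule has_field_derivative_transform_within_open[where f = "\<lambda>s. 0" and S = "{..<0}"])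
        (use 2 in \<open>auto intro!: derivative_eq_intros\<close>)
  qed
qed

lemma DERIV_step [derivative_intros]: "(step has_real_derivative step' s) (at s)"
proof -
  have sh: "((\<lambda>s::real. (max 0 (s - k))\<^sup>2) has_real_derivative 2 * max 0 (s - k)) (at s)" for k
    using DERIV_chain2[OF DERIV_max_0_power2, of "\<lambda>s. s - k" 1 s UNIV]
      DERIV_diff[OF DERIV_ident DERIV_const[of k]] by simp
  show ?thesis
    unfolding step_def[abs_def] step'_def
    by (rule derivative_eq_intros sh sh[of 0, simplified] refl)+ simp
qed

lemma continuous_on_step': "continuous_on S step'"
  unfolding step'_def[abs_def] by (intro continuous_intros)

lemma step_le_0: "s \<le> 0 \<Longrightarrow> step s = 0" and step_ge_1: "s \<ge> 1 \<Longrightarrow> step s = 1"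
  by (auto simp: step_def max_def power2_eq_square field_simps)

lemma step'_outside: "s \<le> 0 \<or> s \<ge> 1 \<Longrightarrow> step' s = 0"
  by (auto simp: step'_def max_def)

lemma step'_nonneg: "0 \<le> step' s" and step'_le_2: "step' s \<le> 2"
  by (auto simp: step'_def max_def)

lemma step'_pos: "0 < s \<Longrightarrow> s < 1 \<Longrightarrow> 0 < step' s"
  by (auto simp: step'_def max_def)

lemma step_mono: "r \<le> s \<Longrightarrow> step r \<le> step s"
  using DERIV_nonneg_imp_nondecreasing[of r s step] DERIV_step step'_nonneg by blast

lemma step_nonneg: "0 \<le> step s" and step_le_1: "step s \<le> 1"
  using step_mono[of "min s 0" s] step_mono[of s "max s 1"] step_le_0[of "min s 0"] step_ge_1[of "max s 1"]
  by auto

lemma C1_step: "C1 F U \<Longrightarrow> C1 (\<lambda>p. step (F p)) U"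
  by (rule C1_compose[OF _ DERIV_step continuous_on_step'])

section \<open>The equation in divergence form\<close>

text \<open>For \<open>\<alpha> = \<rho> / \<phi>\<close> and \<open>\<beta> = \<rho>\<close>,
  \<open>slope\<close> is \<open>W\<close>, and \<open>flux_x\<close>, \<open>flux_t\<close> are the
  components of \<open>f\<^sup>2 \<nabla>u / W\<close>. The exponential factors in
  \<open>f\<^sup>2\<close> and in the inverse of \<open>h\<^sub>c\<close> cancel, so
  \<open>c\<close> survives only in \<open>mass\<close>.\<close>

definition slope where
  "slope \<alpha> \<beta> u p = sqrt (1 + (\<alpha> p * frechet_derivative u (at p) (1, 0))\<^sup>2
     + (\<beta> p * frechet_derivative u (at p) (0, 1))\<^sup>2)"
  for \<alpha> \<beta> u :: "real \<times> real \<Rightarrow> real"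

definition flux_x where
  "flux_x \<alpha> \<beta> u p = (\<alpha> p)\<^sup>2 * frechet_derivative u (at p) (1, 0) / slope \<alpha> \<beta> u p"
  for \<alpha> \<beta> u :: "real \<times> real \<Rightarrow> real"

definition flux_t where
  "flux_t \<alpha> \<beta> u p = (\<beta> p)\<^sup>2 * frechet_derivative u (at p) (0, 1) / slope \<alpha> \<beta> u p"
  for \<alpha> \<beta> u :: "real \<times> real \<Rightarrow> real"

lemma slope_arg_pos: "1 + r\<^sup>2 + s\<^sup>2 > (0 :: real)"
  by (smt (verit) zero_le_power2)

lemma slope_pos: "slope \<alpha> \<beta> u p > 0"
  by (simp add: slope_def slope_arg_pos)

lemma
  assumes "C1 \<alpha> U" "C1 \<beta> U" "C1 (\<lambda>p. frechet_derivative u (at p) (1, 0)) U"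
    "C1 (\<lambda>p. frechet_derivative u (at p) (0, 1)) U"
  shows C1_flux_x: "C1 (flux_x \<alpha> \<beta> u) U" and C1_flux_t: "C1 (flux_t \<alpha> \<beta> u) U"
proof -
  have "C1 (slope \<alpha> \<beta> u) U"
    unfolding slope_def[abs_def]
    by (intro C1_sqrt C1_add C1_power2 C1_mult C1_const assms slope_arg_pos)
  then show "C1 (flux_x \<alpha> \<beta> u) U" "C1 (flux_t \<alpha> \<beta> u) U"
    unfolding flux_x_def[abs_def] flux_t_def[abs_def]
    by (intro C1_divide C1_mult C1_power2 assms less_imp_neq[OF slope_pos, symmetric]; assumption)+
qed

text \<open>The area density of \<open>h\<^sub>c\<close>, that is, the square root of its
  determinant in the coordinates (x, t).\<close>

definition mass :: "base_curve \<Rightarrow> real \<Rightarrow> (complex \<Rightarrow> real) \<Rightarrow> real \<times> real \<Rightarrow> real" where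
  "mass b c \<phi> p = exp (c * snd p) * \<bar>\<phi> (base_pt b (fst p))\<bar>"

definition weight_x :: "base_curve \<Rightarrow> (complex \<Rightarrow> real) \<Rightarrow> (complex \<Rightarrow> real) \<Rightarrow> real \<times> real \<Rightarrow> real" where
  "weight_x b \<phi> \<rho> p = \<rho> (base_pt b (fst p)) / \<phi> (base_pt b (fst p))"

definition weight_t :: "base_curve \<Rightarrow> (complex \<Rightarrow> real) \<Rightarrow> real \<times> real \<Rightarrow> real" where
  "weight_t b \<rho> p = \<rho> (base_pt b (fst p))"

section \<open>Gradient, connection and divergence of the metric in coordinates\<close>

lemma base_pt_in: "base_pt b x \<in> base_set b"
  by (simp add: base_set_def)

lemma smooth_on_base_D:
  assumes "smooth_on_base b \<phi>"
  obtains \<Phi>' where "\<And>x. ((\<lambda>x. \<phi> (base_pt b x)) has_real_derivative \<Phi>' x) (at x)"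
    and "\<And>S. continuous_on S \<Phi>'"
proof -
  let ?\<Phi> = "\<lambda>x. \<phi> (base_pt b x)"
  have "C_on (Suc 0) ?\<Phi> UNIV"
    using assms by (auto simp only: smooth_on_base_def smooth_def o_def)
  then have d: "?\<Phi> differentiable (at x)"
    and c: "continuous_on UNIV (\<lambda>x. frechet_derivative ?\<Phi> (at x) 1)" for x
    by auto
  have "(?\<Phi> has_real_derivative frechet_derivative ?\<Phi> (at x) 1) (at x)" for x
    using d[of x, unfolded frechet_derivative_works] linear_frechet_derivative[OF d[of x]]
    unfolding has_field_derivative_def
    by (metis (no_types, lifting) ext mult.commute mult.right_neutral real_scaleR_def linear_cmul)
  then show ?thesis
    by (rule that) (rule continuous_on_subset[OF c subset_UNIV])
qed

lemma C1_base:
  assumes "smooth_on_base b \<phi>"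
  shows "C1 (\<lambda>p. \<phi> (base_pt b (fst p))) U"
proof -
  obtain \<Phi>' where "\<And>x. ((\<lambda>x. \<phi> (base_pt b x)) has_real_derivative \<Phi>' x) (at x)"
    and "\<And>S. continuous_on S \<Phi>'"
    by (rule smooth_on_base_D[OF assms]) blast
  then show ?thesis
    by (intro C1_compose[OF C1_fst])
qed

text \<open>\<open>grad\<close> and \<open>christoffel\<close> are both definite descriptions of the
  vector that represents a linear form. As the metric is diagonal with nonzero entries, representing
  a form amounts to dividing its two coefficients, and the vector is unique.\<close>

lemma THE_hmet:
  assumes "\<phi> (base_pt b (fst p)) \<noteq> 0"
  shows "(THE y. \<forall>z. hmet b c \<phi> p y z = r * fst z + s * snd z) =
    (r / (exp (c * snd p) * (\<phi> (base_pt b (fst p)))\<^sup>2), s / exp (c * snd p))"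
    (is "(THE y. ?P y) = ?y")
proof (rule the_equality)
  show "?P ?y"
    using assms by (simp add: hmet_def field_simps)
  fix y assume y: "?P y"
  show "y = ?y"
    using spec[OF y, of "(1, 0)"] spec[OF y, of "(0, 1)"] assms
    by (cases y) (auto simp: hmet_def field_simps)
qed

lemma grad_hmet:
  assumes "\<phi> (base_pt b (fst p)) \<noteq> 0" "u differentiable (at p)"
  shows "grad (hmet b c \<phi>) u p =
    (frechet_derivative u (at p) (1, 0) / (exp (c * snd p) * (\<phi> (base_pt b (fst p)))\<^sup>2),
     frechet_derivative u (at p) (0, 1) / exp (c * snd p))"
proof -
  define r s where "r = frechet_derivative u (at p) (1, 0)" and "s = frechet_derivative u (at p) (0, 1)"
  have "frechet_derivative u (at p) z = r * fst z + s * snd z" for z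
    using frechet_derivative_prod[OF assms(2), of z] by (simp only: r_def s_def mult.commute)
  then show ?thesis
    unfolding grad_def r_def[symmetric] s_def[symmetric]
    by (simp only: THE_hmet[where \<phi> = \<phi> and b = b and p = p, OF assms(1)])
qed

lemma Wfun_hmet:
  assumes "\<phi> (base_pt b (fst p)) \<noteq> 0" "u differentiable (at p)"
  shows "Wfun b c \<phi> \<rho> u p = slope (weight_x b \<phi> \<rho>) (weight_t b \<rho>) u p"
proof -
  let ?e = "exp (c * snd p)"
  have e: "exp (c * snd p / 2) ^ 2 = ?e"
    by (simp add: power2_eq_square flip: exp_add)
  show ?thesis
    using assms(1)
    unfolding Wfun_def slope_def grad_hmet[where \<phi> = \<phi> and b = b and p = p, OF assms] fweight_def hmet_def weight_x_def weight_t_def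
      power_mult_distrib e
    by (simp add: field_simps power2_eq_square)
qed

lemma flux_hmet:
  assumes "\<phi> (base_pt b (fst p)) \<noteq> 0" "u differentiable (at p)"
  shows "((fweight b c \<rho> p)\<^sup>2 / Wfun b c \<phi> \<rho> u p) *\<^sub>R grad (hmet b c \<phi>) u p =
    (flux_x (weight_x b \<phi> \<rho>) (weight_t b \<rho>) u p, flux_t (weight_x b \<phi> \<rho>) (weight_t b \<rho>) u p)"
proof -
  have e: "exp (c * snd p / 2) ^ 2 = exp (c * snd p)"
    by (simp add: power2_eq_square flip: exp_add)
  show ?thesis
    using assms(1)
    unfolding Wfun_hmet[where \<phi> = \<phi> and b = b and p = p, OF assms] grad_hmet[where \<phi> = \<phi> and b = b and p = p, OF assms] fweight_def flux_x_def flux_t_def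
      weight_x_def[of b \<phi> \<rho> p] weight_t_def[of b \<rho> p] power_mult_distrib e
    by (simp add: field_simps)
qed

lemma frechet_derivative_hmet:
  assumes "((\<lambda>x. \<phi> (base_pt b x)) has_real_derivative d) (at (fst p))"
  shows "frechet_derivative (\<lambda>q. hmet b c \<phi> q v w) (at p) z =
    exp (c * snd p) * (c * snd z * ((\<phi> (base_pt b (fst p)))\<^sup>2 * fst v * fst w + snd v * snd w)
      + 2 * \<phi> (base_pt b (fst p)) * d * fst z * fst v * fst w)"
proof -
  have \<Phi>: "((\<lambda>q. \<phi> (base_pt b (fst q))) has_derivative (\<lambda>z. d * fst z)) (at p)"
    using has_derivative_compose[of fst fst p UNIV "\<lambda>x. \<phi> (base_pt b x)" "(*) d"] assms
    by (simp add: has_field_derivative_def has_derivative_fst[OF has_derivative_ident])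
  have "((\<lambda>q. hmet b c \<phi> q v w) has_derivative (\<lambda>z.
    exp (c * snd p) * (c * snd z * ((\<phi> (base_pt b (fst p)))\<^sup>2 * fst v * fst w + snd v * snd w)
      + 2 * \<phi> (base_pt b (fst p)) * d * fst z * fst v * fst w))) (at p)"
    unfolding hmet_def power2_eq_square
    by (rule derivative_eq_intros \<Phi> refl)+ (simp add: fun_eq_iff algebra_simps)
  from frechet_derivative_at[OF this] show ?thesis
    by (rule fun_cong[OF sym])
qed

text \<open>These are the two components that enter the trace in \<open>diverg\<close>. The
  right-hand side of the Koszul formula is sorted as a linear form in \<open>z\<close>, so that
  \<open>THE_hmet\<close> reads off the representing vector.\<close>

lemma christoffel_hmet:
  assumes "\<phi> (base_pt b (fst p)) \<noteq> 0"
    and d: "((\<lambda>x. \<phi> (base_pt b x)) has_real_derivative d) (at (fst p))"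
  shows "fst (christoffel (hmet b c \<phi>) p (1, 0) w) = c * snd w / 2 + d / \<phi> (base_pt b (fst p)) * fst w"
    and "snd (christoffel (hmet b c \<phi>) p (0, 1) w) = c * snd w / 2"
proof -
  let ?e = "exp (c * snd p)" and ?\<Phi> = "\<phi> (base_pt b (fst p))"
  have "(frechet_derivative (\<lambda>q. hmet b c \<phi> q w z) (at p) (1, 0)
     + frechet_derivative (\<lambda>q. hmet b c \<phi> q (1, 0) z) (at p) w
     - frechet_derivative (\<lambda>q. hmet b c \<phi> q (1, 0) w) (at p) z) / 2 =
     (?e * (c * snd w * ?\<Phi>\<^sup>2 / 2 + ?\<Phi> * d * fst w)) * fst z + (- ?e * c * ?\<Phi>\<^sup>2 * fst w / 2) * snd z" for z
    unfolding frechet_derivative_hmet[OF d] by (simp add: field_simps)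
  then show "fst (christoffel (hmet b c \<phi>) p (1, 0) w) = c * snd w / 2 + d / ?\<Phi> * fst w"
    using assms(1) unfolding christoffel_def THE_hmet[where \<phi> = \<phi> and b = b and p = p, OF assms(1)]
    by (simp only: THE_hmet[where \<phi> = \<phi> and b = b and p = p, OF assms(1)]) (simp add: field_simps power2_eq_square)
  have "(frechet_derivative (\<lambda>q. hmet b c \<phi> q w z) (at p) (0, 1)
     + frechet_derivative (\<lambda>q. hmet b c \<phi> q (0, 1) z) (at p) w
     - frechet_derivative (\<lambda>q. hmet b c \<phi> q (0, 1) w) (at p) z) / 2 =
     (?e * c * ?\<Phi>\<^sup>2 * fst w / 2) * fst z + (?e * c * snd w / 2) * snd z" for z
    unfolding frechet_derivative_hmet[OF d] by (simp add: field_simps)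
  then show "snd (christoffel (hmet b c \<phi>) p (0, 1) w) = c * snd w / 2"
    unfolding christoffel_def by (simp only: THE_hmet[where \<phi> = \<phi> and b = b and p = p, OF assms(1)]) simp
qed

text \<open>The coefficients \<open>d / \<phi>\<close> and \<open>c\<close> are the logarithmic
  derivatives of \<open>mass\<close> in x and t; \<open>c\<close> arises as c/2 from each of the two
  diagonal terms. \<open>Z\<close> is compared with \<open>(X, Y)\<close> only near
  \<open>p\<close>, because \<open>flux_hmet\<close> is available only where the solution is
  differentiable.\<close>

lemma diverg_hmet:
  assumes "\<phi> (base_pt b (fst p)) \<noteq> 0"
    and d: "((\<lambda>x. \<phi> (base_pt b x)) has_real_derivative d) (at (fst p))"
    and "open U" "p \<in> U" and Z: "\<And>q. q \<in> U \<Longrightarrow> Z q = (X q, Y q)"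
    and X: "X differentiable (at p)" and Y: "Y differentiable (at p)"
  shows "diverg (hmet b c \<phi>) Z p =
    frechet_derivative X (at p) (1, 0) + d / \<phi> (base_pt b (fst p)) * X p
    + (frechet_derivative Y (at p) (0, 1) + c * Y p)"
proof -
  have "((\<lambda>q. (X q, Y q)) has_derivative
      (\<lambda>v. (frechet_derivative X (at p) v, frechet_derivative Y (at p) v))) (at p)"
    using X Y by (intro has_derivative_Pair) (simp_all flip: frechet_derivative_works)
  then have "(Z has_derivative
      (\<lambda>v. (frechet_derivative X (at p) v, frechet_derivative Y (at p) v))) (at p)"
    by (rule has_derivative_transform_within_open[OF _ \<open>open U\<close> \<open>p \<in> U\<close>]) (simp add: Z)
  from frechet_derivative_at[OF this, symmetric]
  have fZ: "frechet_derivative Z (at p) =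
      (\<lambda>v. (frechet_derivative X (at p) v, frechet_derivative Y (at p) v))" .
  have B: "(Basis :: (real \<times> real) set) = {(1, 0), (0, 1)}"
    by (auto simp: Basis_prod_def)
  have "diverg (hmet b c \<phi>) Z p =
      frechet_derivative X (at p) (1, 0) + fst (christoffel (hmet b c \<phi>) p (1, 0) (Z p)) +
      (frechet_derivative Y (at p) (0, 1) + snd (christoffel (hmet b c \<phi>) p (0, 1) (Z p)))"
    unfolding diverg_def cov_deriv_def B fZ by (simp add: inner_prod_def)
  also have "\<dots> = frechet_derivative X (at p) (1, 0)
      + (c * snd (Z p) / 2 + d / \<phi> (base_pt b (fst p)) * fst (Z p))
      + (frechet_derivative Y (at p) (0, 1) + c * snd (Z p) / 2)"
    by (simp only: christoffel_hmet[where \<phi> = \<phi> and b = b and p = p, OF assms(1) d])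
  also have "\<dots> = frechet_derivative X (at p) (1, 0) + d / \<phi> (base_pt b (fst p)) * X p
    + (frechet_derivative Y (at p) (0, 1) + c * Y p)"
    by (simp add: Z[OF \<open>p \<in> U\<close>])
  finally show ?thesis .
qed

section \<open>The coordinate map onto the surface\<close>

lemma pt_continuous: "continuous_on S (pt b)"
proof -
  have "continuous_on S (\<lambda>p. base_pt b (fst p))"
    by (cases b) (auto intro!: continuous_intros simp: cis_conv_exp)
  then show ?thesis unfolding pt_def[abs_def] by (intro continuous_intros)
qed

lemma pt_in_surf: "pt b p \<in> surf b"
  by (simp add: pt_def surf_def base_pt_in)

lemma surf_pt: "P \<in> surf b \<Longrightarrow> \<exists>p. pt b p = P"
  by (auto simp: surf_def base_set_def pt_def)

lemma open_pt_vimage: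
  assumes "openin (top_of_set (surf b)) \<Omega>"
  shows "open (pt b -` \<Omega>)"
proof -
  obtain T where "open T" "\<Omega> = surf b \<inter> T"
    using assms by (auto simp: openin_open)
  then have "pt b -` \<Omega> = pt b -` T"
    using pt_in_surf by blast
  then show ?thesis
    using \<open>open T\<close> pt_continuous[of UNIV b] by (simp add: open_vimage)
qed

text \<open>A continuous function without zeros on the line keeps its sign. The sign of
  \<open>\<phi>\<close> is not prescribed, and this is what makes \<open>\<bar>\<phi>\<bar>\<close>,
  and with it the density \<open>mass\<close>, continuously differentiable.\<close>

lemma abs_nonvanishing:
  assumes "continuous_on UNIV f" "\<And>x. f x \<noteq> 0"
  obtains \<sigma> :: real where "\<And>x :: real. \<bar>f x\<bar> = \<sigma> * f x"
proof -
  have "connected (range f)" 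
    using assms by (intro connected_continuous_image) auto
  then have "(\<forall>x. f x > 0) \<or> (\<forall>x. f x < 0)"
    using connectedD_interval[of "range f" _ _ 0] assms(2) 
    by (metis linorder_neqE_linordered_idom less_imp_le rangeI rangeE)
  then show ?thesis
  proof
    assume "\<forall>x. f x > 0"
    then show ?thesis by (intro that[of 1]) (simp add: abs_of_pos)
  next
    assume "\<forall>x. f x < 0"
    then show ?thesis by (intro that[of "-1"]) (simp add: abs_of_neg)
  qed
qed

section \<open>The solution equation as a conservation law\<close>

locale weights =
  fixes b :: base_curve and c :: real and \<phi> \<rho> :: "complex \<Rightarrow> real"
  assumes smooth_\<phi>: "smooth_on_base b \<phi>" and \<phi>_nz: "\<And>z. z \<in> base_set b \<Longrightarrow> \<phi> z \<noteq> 0"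
    and smooth_\<rho>: "smooth_on_base b \<rho>"
begin

abbreviation "\<alpha> \<equiv> weight_x b \<phi> \<rho>"
abbreviation "\<beta> \<equiv> weight_t b \<rho>"
abbreviation "\<mu> \<equiv> mass b c \<phi>"

lemma \<phi>_base_nz: "\<phi> (base_pt b x) \<noteq> 0"
  by (simp add: \<phi>_nz base_pt_in)

lemma mass_pos: "\<mu> p > 0"
  by (simp add: mass_def \<phi>_base_nz)

lemma C1_weight_x: "C1 \<alpha> U"
  unfolding weight_x_def[abs_def] by (intro C1_divide C1_base smooth_\<phi> smooth_\<rho> \<phi>_base_nz)

lemma C1_weight_t: "C1 \<beta> U"
  unfolding weight_t_def[abs_def] by (intro C1_base smooth_\<rho>)

lemma mass_derivative:
  assumes d: "((\<lambda>x. \<phi> (base_pt b x)) has_real_derivative d) (at (fst p))"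
  shows "C1 \<mu> UNIV" "frechet_derivative \<mu> (at p) (1, 0) = \<mu> p * (d / \<phi> (base_pt b (fst p)))"
    "frechet_derivative \<mu> (at p) (0, 1) = \<mu> p * c"
proof -
  obtain \<Phi>' where \<Phi>: "\<And>x. ((\<lambda>x. \<phi> (base_pt b x)) has_real_derivative \<Phi>' x) (at x)"
    by (rule smooth_on_base_D[OF smooth_\<phi>]) blast
  have "continuous_on UNIV (\<lambda>x. \<phi> (base_pt b x))"
    using DERIV_isCont[OF \<Phi>] continuous_at_imp_continuous_on by blast
  then obtain \<sigma> where \<sigma>: "\<bar>\<phi> (base_pt b x)\<bar> = \<sigma> * \<phi> (base_pt b x)" for x
    by (rule abs_nonvanishing) (auto simp: \<phi>_base_nz)
  have \<mu>: "\<mu> = (\<lambda>p. exp (c * snd p) * (\<sigma> * \<phi> (base_pt b (fst p))))"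
    by (simp add: mass_def[abs_def] \<sigma>)
  have "C1 (\<lambda>p. exp (c * snd p)) UNIV"
    by (rule C1_compose[OF C1_snd, where g' = "\<lambda>x. c * exp (c * x)"])
      (auto intro!: derivative_eq_intros continuous_intros)
  then show "C1 \<mu> UNIV"
    unfolding \<mu> by (intro C1_mult C1_const C1_base smooth_\<phi>)
  have \<Phi>: "((\<lambda>q. \<phi> (base_pt b (fst q))) has_derivative (\<lambda>z. d * fst z)) (at p)"
    using has_derivative_compose[of fst fst p UNIV "\<lambda>x. \<phi> (base_pt b x)" "(*) d"] d
    by (simp add: has_field_derivative_def has_derivative_fst[OF has_derivative_ident])
  have "(\<mu> has_derivative (\<lambda>z. exp (c * snd p) * \<sigma> * (c * snd z * \<phi> (base_pt b (fst p)) + d * fst z))) (at p)"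
    unfolding \<mu> by (rule derivative_eq_intros \<Phi> refl)+ (simp add: fun_eq_iff algebra_simps)
  from frechet_derivative_at[OF this, symmetric]
  show "frechet_derivative \<mu> (at p) (1, 0) = \<mu> p * (d / \<phi> (base_pt b (fst p)))"
    "frechet_derivative \<mu> (at p) (0, 1) = \<mu> p * c"
    using \<phi>_base_nz[of "fst p"] by (simp_all add: \<mu>)
qed

lemma C1_mass: "C1 \<mu> U"
proof -
  obtain \<Phi>' where "\<And>x. ((\<lambda>x. \<phi> (base_pt b x)) has_real_derivative \<Phi>' x) (at x)"
    by (rule smooth_on_base_D[OF smooth_\<phi>]) blast
  from mass_derivative(1)[OF this] show ?thesis
    by (rule C1_subset) simp
qed

lemma solution_C1:
  assumes "is_solution b c \<phi> \<rho> \<Omega> u"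
  shows "C1 (u \<circ> pt b) (pt b -` \<Omega>)"
    and "C1 (flux_x \<alpha> \<beta> (u \<circ> pt b)) (pt b -` \<Omega>)"
    and "C1 (flux_t \<alpha> \<beta> (u \<circ> pt b)) (pt b -` \<Omega>)"
proof -
  have s: "smooth (u \<circ> pt b) (pt b -` \<Omega>)"
    using assms by (simp add: is_solution_def)
  show "C1 (u \<circ> pt b) (pt b -` \<Omega>)"
    by (rule C1_smooth[OF s])
  show "C1 (flux_x \<alpha> \<beta> (u \<circ> pt b)) (pt b -` \<Omega>)" "C1 (flux_t \<alpha> \<beta> (u \<circ> pt b)) (pt b -` \<Omega>)"
    by (intro C1_flux_x C1_flux_t C1_weight_x C1_weight_t C1_smooth_deriv[OF s];
        simp add: Basis_prod_def)+
qed

text \<open>The Riemannian divergence is \<open>1 / \<mu>\<close> times the coordinate divergence of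
  \<open>\<mu>\<close> times the field: the Christoffel terms of \<open>diverg_hmet\<close> match
  the derivatives of \<open>\<mu>\<close> in the product rule. The result is a plain divergence that
  can be integrated in the plane.\<close>

lemma solution_conservation:
  assumes "openin (top_of_set (surf b)) \<Omega>" "is_solution b c \<phi> \<rho> \<Omega> u" "p \<in> pt b -` \<Omega>"
  shows "frechet_derivative (\<lambda>q. \<mu> q * flux_x \<alpha> \<beta> (u \<circ> pt b) q) (at p) (1, 0) +
    frechet_derivative (\<lambda>q. \<mu> q * flux_t \<alpha> \<beta> (u \<circ> pt b) q) (at p) (0, 1) = 0"
proof -
  let ?v = "u \<circ> pt b" and ?U = "pt b -` \<Omega>"
  obtain \<Phi>' where \<Phi>: "\<And>x. ((\<lambda>x. \<phi> (base_pt b x)) has_real_derivative \<Phi>' x) (at x)"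
    by (rule smooth_on_base_D[OF smooth_\<phi>]) blast
  note C = solution_C1[OF assms(2)]
  have v: "?v differentiable (at q)" if "q \<in> ?U" for q
    using C(1) that by (auto simp: C1_def)
  have f: "flux_x \<alpha> \<beta> ?v differentiable (at p)" "flux_t \<alpha> \<beta> ?v differentiable (at p)"
    using C(2,3) assms(3) by (simp_all add: C1_def)
  have m: "\<mu> differentiable (at p)"
    using C1_mass[of UNIV] unfolding C1_def by blast
  have "0 = diverg (hmet b c \<phi>)
    (\<lambda>q. ((fweight b c \<rho> q)\<^sup>2 / Wfun b c \<phi> \<rho> ?v q) *\<^sub>R grad (hmet b c \<phi>) ?v q) p"
    using assms by (simp add: is_solution_def)
  also have "\<dots> = frechet_derivative (flux_x \<alpha> \<beta> ?v) (at p) (1, 0)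
      + \<Phi>' (fst p) / \<phi> (base_pt b (fst p)) * flux_x \<alpha> \<beta> ?v p
      + (frechet_derivative (flux_t \<alpha> \<beta> ?v) (at p) (0, 1) + c * flux_t \<alpha> \<beta> ?v p)"
    by (rule diverg_hmet[OF \<phi>_base_nz \<Phi> open_pt_vimage[OF assms(1)] assms(3) _ f])
      (rule flux_hmet, simp_all only: \<phi>_base_nz v not_False_eq_True)
  finally show ?thesis
    unfolding frechet_derivative_mult[OF m f(1)] frechet_derivative_mult[OF m f(2)]
      mass_derivative(2,3)[OF \<Phi>]
    using mass_pos[of p] by (simp add: algebra_simps) algebra
qed

end

section \<open>Monotonicity of the flux\<close>

text \<open>Cauchy-Schwarz for the vectors (r, s, 1) and (r', s', 1), with the defect written out by
  Lagrange's identity.\<close>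

lemma slope_prod_ge:
  fixes r s r' s' :: real
  shows "r * r' + s * s' + 1 \<le> sqrt (1 + r\<^sup>2 + s\<^sup>2) * sqrt (1 + r'\<^sup>2 + s'\<^sup>2)"
proof -
  have "(r * r' + s * s' + 1)\<^sup>2 + ((r * s' - s * r')\<^sup>2 + (r - r')\<^sup>2 + (s - s')\<^sup>2) =
    (1 + r\<^sup>2 + s\<^sup>2) * (1 + r'\<^sup>2 + s'\<^sup>2)"
    by algebra
  then have "(r * r' + s * s' + 1)\<^sup>2 \<le> (1 + r\<^sup>2 + s\<^sup>2) * (1 + r'\<^sup>2 + s'\<^sup>2)"
    by (smt (verit) zero_le_power2)
  then show ?thesis
    by (metis real_le_rsqrt real_sqrt_mult)
qed

text \<open>With the unit normals \<open>n = (r, s, -1) / W\<close>, the left-hand side is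
  \<open>(W n - W' n') \<bullet> (n - n') = (W + W') / 2 * \<bar>n - n'\<bar>\<^sup>2\<close>.\<close>

lemma flux_monotone:
  fixes r s r' s' :: real
  defines "W \<equiv> sqrt (1 + r\<^sup>2 + s\<^sup>2)" and "W' \<equiv> sqrt (1 + r'\<^sup>2 + s'\<^sup>2)"
  shows "(r / W - r' / W') * (r - r') + (s / W - s' / W') * (s - s') =
    (W + W') / 2 * ((r / W - r' / W')\<^sup>2 + (s / W - s' / W')\<^sup>2 + (1 / W - 1 / W')\<^sup>2)"
proof -
  have W: "W > 0" "W' > 0" by (simp_all add: W_def W'_def slope_arg_pos)
  have W2: "W\<^sup>2 = 1 + r\<^sup>2 + s\<^sup>2" "W'\<^sup>2 = 1 + r'\<^sup>2 + s'\<^sup>2"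
    using slope_arg_pos[of r s] slope_arg_pos[of r' s'] by (simp_all add: W_def W'_def)
  define R S I R' S' I' where d: "R = r / W" "S = s / W" "I = 1 / W" "R' = r' / W'" "S' = s' / W'" "I' = 1 / W'"
  have e: "r = W * R" "s = W * S" "1 = W * I" "r' = W' * R'" "s' = W' * S'" "1 = W' * I'"
    using W by (auto simp: d)
  have "W\<^sup>2 * (R\<^sup>2 + S\<^sup>2 + I\<^sup>2) = W\<^sup>2" "W'\<^sup>2 * (R'\<^sup>2 + S'\<^sup>2 + I'\<^sup>2) = W'\<^sup>2"
    using W2 e by algebra+
  then have n: "R\<^sup>2 + S\<^sup>2 + I\<^sup>2 = 1" "R'\<^sup>2 + S'\<^sup>2 + I'\<^sup>2 = 1"
    using W by simp_all
  have "(R - R') * (r - r') + (S - S') * (s - s') = (W + W') / 2 * ((R - R')\<^sup>2 + (S - S')\<^sup>2 + (I - I')\<^sup>2)"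
    using e n by algebra
  then show ?thesis by (simp add: d)
qed

locale gradients =
  fixes \<alpha> \<beta> u1 u2 :: "real \<times> real \<Rightarrow> real" and p :: "real \<times> real"
begin

abbreviation "jump_x \<equiv> flux_x \<alpha> \<beta> u1 p - flux_x \<alpha> \<beta> u2 p"
abbreviation "jump_t \<equiv> flux_t \<alpha> \<beta> u1 p - flux_t \<alpha> \<beta> u2 p"
abbreviation "pairing u \<equiv> jump_x * frechet_derivative u (at p) (1, 0) + jump_t * frechet_derivative u (at p) (0, 1)"

text \<open>The difference of the pairings is the monotone expression of
  \<open>flux_monotone\<close>, a positive multiple of the squared distance of unit normals; equal
  normals have equal last components, hence equal \<open>W\<close> and equal slopes. The one-sided
  bounds come from \<open>slope_prod_ge\<close>, which gives
  \<open>pairing u2 \<le> 1 / W' - 1 / W\<close> and \<open>pairing u1 \<ge> 1 / W' - 1 / W\<close>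
  with \<open>W, W' \<ge> 1\<close>. They are uniform in the size of the gradients.\<close>

lemma pairing_diff_nonneg: "pairing u1 - pairing u2 \<ge> 0"
  and pairing_diff_eq_0D: "pairing u1 - pairing u2 = 0 \<Longrightarrow> \<alpha> p \<noteq> 0 \<Longrightarrow> \<beta> p \<noteq> 0 \<Longrightarrow>
      frechet_derivative u1 (at p) (1, 0) = frechet_derivative u2 (at p) (1, 0) \<and>
      frechet_derivative u1 (at p) (0, 1) = frechet_derivative u2 (at p) (0, 1)"
  and pairing_le: "pairing u2 \<le> 1" and pairing_ge: "pairing u1 \<ge> -1"
proof -
  define r s r' s' where d: "r = \<alpha> p * frechet_derivative u1 (at p) (1, 0)"
    "s = \<beta> p * frechet_derivative u1 (at p) (0, 1)"
    "r' = \<alpha> p * frechet_derivative u2 (at p) (1, 0)"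
    "s' = \<beta> p * frechet_derivative u2 (at p) (0, 1)"
  define W W' where W: "W = sqrt (1 + r\<^sup>2 + s\<^sup>2)" "W' = sqrt (1 + r'\<^sup>2 + s'\<^sup>2)"
  have f: "slope \<alpha> \<beta> u1 p = W" "slope \<alpha> \<beta> u2 p = W'"
    by (simp_all add: W d slope_def)
  have W2: "W\<^sup>2 = 1 + r\<^sup>2 + s\<^sup>2" "W'\<^sup>2 = 1 + r'\<^sup>2 + s'\<^sup>2"
    using slope_arg_pos[of r s] slope_arg_pos[of r' s'] by (simp_all add: W)
  have W1: "W \<ge> 1" "W' \<ge> 1" by (simp_all add: W)
  have p1: "pairing u1 = (r\<^sup>2 + s\<^sup>2) / W - (r * r' + s * s') / W'"
    and p2: "pairing u2 = (r * r' + s * s') / W - (r'\<^sup>2 + s'\<^sup>2) / W'"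
    unfolding flux_x_def flux_t_def f
    by (simp_all add: d power2_eq_square algebra_simps add_divide_distrib)
  have D: "pairing u1 - pairing u2 = (W + W') / 2 * ((r / W - r' / W')\<^sup>2 + (s / W - s' / W')\<^sup>2 + (1 / W - 1 / W')\<^sup>2)"
    unfolding p1 p2 W flux_monotone[symmetric]
    by (simp add: power2_eq_square algebra_simps add_divide_distrib diff_divide_distrib)
  show "pairing u1 - pairing u2 \<ge> 0"
    unfolding D using W1 by (intro mult_nonneg_nonneg add_nonneg_nonneg) auto
  have le: "r * r' + s * s' \<le> W * W' - 1"
    using slope_prod_ge[of r r' s s'] by (simp add: W)
  have "(r * r' + s * s') / W \<le> (W * W' - 1) / W" "(r * r' + s * s') / W' \<le> (W * W' - 1) / W'"
    using le W1 by (simp_all add: divide_right_mono)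
  moreover have "(W * W' - 1) / W = W' - 1 / W" "(W * W' - 1) / W' = W - 1 / W'"
    using W1 by (simp_all add: field_simps)
  moreover have "(r\<^sup>2 + s\<^sup>2) / W = W - 1 / W" "(r'\<^sup>2 + s'\<^sup>2) / W' = W' - 1 / W'"
    using W1 W2 by (simp_all add: field_simps flip: power2_eq_square)
  moreover have "1 / W \<le> 1" "1 / W \<ge> 0" "1 / W' \<le> 1" "1 / W' \<ge> 0"
    using W1 by simp_all
  ultimately show "pairing u2 \<le> 1" "pairing u1 \<ge> -1"
    unfolding p1 p2 by linarith+
  show "frechet_derivative u1 (at p) (1, 0) = frechet_derivative u2 (at p) (1, 0) \<and>
      frechet_derivative u1 (at p) (0, 1) = frechet_derivative u2 (at p) (0, 1)"
    if "pairing u1 - pairing u2 = 0" "\<alpha> p \<noteq> 0" "\<beta> p \<noteq> 0"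
  proof -
    have "(r / W - r' / W')\<^sup>2 + (s / W - s' / W')\<^sup>2 + (1 / W - 1 / W')\<^sup>2 = 0"
      using that(1) W1 unfolding D by simp
    then have "r / W = r' / W'" "s / W = s' / W'" "1 / W = 1 / W'"
      by (smt (verit) zero_le_power2 zero_eq_power2)+
    then have "r = r'" "s = s'"
      using W1 by auto
    then show ?thesis using that(2,3) by (simp add: d)
  qed
qed

end

text \<open>Since \<open>\<bar>\<xi>\<bar> \<le> W\<close>, the fluxes stay bounded however steep
  \<open>u\<close> is. Hence cutoffs whose gradient is small in the L1 norm are enough to remove the
  vertices.\<close>

lemma flux_x_bound: "\<bar>flux_x \<alpha> \<beta> u p\<bar> \<le> \<bar>\<alpha> p\<bar>" and flux_t_bound: "\<bar>flux_t \<alpha> \<beta> u p\<bar> \<le> \<bar>\<beta> p\<bar>"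
proof -
  let ?r = "\<alpha> p * frechet_derivative u (at p) (1, 0)" and ?s = "\<beta> p * frechet_derivative u (at p) (0, 1)"
  have sq: "\<bar>r\<bar> \<le> sqrt (1 + r\<^sup>2 + s\<^sup>2)" "\<bar>s\<bar> \<le> sqrt (1 + r\<^sup>2 + s\<^sup>2)" for r s :: real
    by (rule real_le_rsqrt, simp)+
  have "\<bar>?r\<bar> \<le> slope \<alpha> \<beta> u p" "\<bar>?s\<bar> \<le> slope \<alpha> \<beta> u p"
    unfolding slope_def by (rule sq)+
  then have "\<bar>?r / slope \<alpha> \<beta> u p\<bar> \<le> 1" "\<bar>?s / slope \<alpha> \<beta> u p\<bar> \<le> 1"
    using slope_pos[of \<alpha> \<beta> u p] by (simp_all add: abs_mult)
  from mult_left_mono[OF this(1), of "\<bar>\<alpha> p\<bar>"] mult_left_mono[OF this(2), of "\<bar>\<beta> p\<bar>"]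
  show "\<bar>flux_x \<alpha> \<beta> u p\<bar> \<le> \<bar>\<alpha> p\<bar>" "\<bar>flux_t \<alpha> \<beta> u p\<bar> \<le> \<bar>\<beta> p\<bar>"
    unfolding flux_x_def flux_t_def by (simp_all add: power2_eq_square abs_mult mult.assoc)
qed

section \<open>Points have zero capacity\<close>

text \<open>\<open>base_pt b\<close> has unit speed, so half the derivative is the tangential
  component of \<open>base_pt b x - z\<close>. On the circle this is the imaginary part of the
  difference after rotating it back by \<open>cis x\<close>.\<close>

lemma base_dist_derivative:
  obtains d where "\<And>x. ((\<lambda>x. (norm (base_pt b x - z))\<^sup>2) has_real_derivative d x) (at x)"
    and "\<And>x. \<bar>d x\<bar> \<le> 2 * norm (base_pt b x - z)" and "\<And>S. continuous_on S d"
proof (cases b)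
  case Line
  have "((\<lambda>x. (norm (base_pt b x - z))\<^sup>2) has_real_derivative 2 * (x - Re z)) (at x)" for x
    unfolding cmod_power2 Line by (auto intro!: derivative_eq_intros)
  moreover have "\<bar>2 * (x - Re z)\<bar> \<le> 2 * norm (base_pt b x - z)" for x
    using abs_Re_le_cmod[of "base_pt b x - z"] by (simp add: Line)
  ultimately show ?thesis
    by (rule that) (intro continuous_intros)
next
  case Circle
  let ?d = "\<lambda>x. 2 * (cos x * (sin x - Im z) - sin x * (cos x - Re z))"
  have "((\<lambda>x. (norm (base_pt b x - z))\<^sup>2) has_real_derivative ?d x) (at x)" for x
    unfolding cmod_power2 Circle by (auto intro!: derivative_eq_intros)
  moreover have "\<bar>?d x\<bar> \<le> 2 * norm (base_pt b x - z)" for x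
  proof -
    have "cos x * (sin x - Im z) - sin x * (cos x - Re z) = Im (cnj (cis x) * (cis x - z))"
      by (simp add: algebra_simps)
    also have "\<bar>\<dots>\<bar> \<le> norm (cnj (cis x) * (cis x - z))"
      by (rule abs_Im_le_cmod)
    finally show ?thesis by (simp add: norm_mult Circle)
  qed
  ultimately show ?thesis
    by (rule that) (intro continuous_intros)
qed

lemma negligible_base_fiber: "negligible {x. base_pt b x = z}"
proof (cases "\<exists>x0. base_pt b x0 = z")
  case True
  then obtain x0 where x0: "base_pt b x0 = z" by blast
  have "{x. base_pt b x = z} \<subseteq> range (\<lambda>n::int. x0 + 2 * pi * n)"
  proof (cases b)
    case Line
    then show ?thesis using x0 by (auto intro!: range_eqI[of _ _ 0])
  next
    case Circle
    show ?thesis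
    proof
      fix x assume "x \<in> {x. base_pt b x = z}"
      then have "sin x = sin x0 \<and> cos x = cos x0"
        using x0 Circle by (auto simp: complex_eq_iff)
      then obtain n :: int where "x = x0 + 2 * pi * n"
        by (auto simp: sin_cos_eq_iff)
      then show "x \<in> range (\<lambda>n::int. x0 + 2 * pi * n)" by blast
    qed
  qed
  then have "countable {x. base_pt b x = z}"
    by (rule countable_subset) auto
  then have "negligible (\<Union>x\<in>{x. base_pt b x = z}. {x})"
    by (intro negligible_countable_Union) auto
  then show ?thesis by simp
next
  case False
  then have "{x. base_pt b x = z} = {}" by auto
  then show ?thesis by simp
qed

lemma base_pt_continuous: "continuous_on S (base_pt b)"
  by (cases b) (auto intro!: continuous_intros simp: cis_conv_exp)

text \<open>This integral is what remains once the gradient of a cutoff has been integrated in t.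
  The integrands are bounded by 3 and tend to 0 off the fibre over \<open>z\<close>, which is
  countable and hence null, so dominated convergence applies.\<close>

lemma fiber_integral_tendsto_0:
  "(\<lambda>n. integral {x1..x2} (\<lambda>x. max 0 (3 - real n * norm (base_pt b x - z)))) \<longlonglongrightarrow> 0"
proof -
  let ?g = "\<lambda>x. if base_pt b x = z then 3 else 0 :: real"
  have i: "(\<lambda>x. max 0 (3 - real n * norm (base_pt b x - z))) integrable_on {x1..x2}" for n
    by (intro integrable_continuous_real continuous_intros base_pt_continuous)
  have l: "(\<lambda>n. max 0 (3 - real n * norm (base_pt b x - z))) \<longlonglongrightarrow> ?g x" for x
  proof (cases "base_pt b x = z")
    case False
    then have "filterlim (\<lambda>n. real n * norm (base_pt b x - z)) at_top sequentially"
      by (intro filterlim_at_top_mult_tendsto_pos[OF tendsto_const _ filterlim_real_sequentially]) simp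
    then have "\<forall>\<^sub>F n in sequentially. real n * norm (base_pt b x - z) \<ge> 3"
      by (simp add: filterlim_at_top)
    then have "\<forall>\<^sub>F n in sequentially. max 0 (3 - real n * norm (base_pt b x - z)) = 0"
      by eventually_elim simp
    then show ?thesis using False by (simp add: tendsto_eventually)
  qed simp
  have "(\<lambda>n. integral {x1..x2} (\<lambda>x. max 0 (3 - real n * norm (base_pt b x - z)))) \<longlonglongrightarrow> integral {x1..x2} ?g"
    by (rule dominated_convergence(2)[OF i integrable_const_ivl[of 3] _ l]) simp
  moreover have "integral {x1..x2} ?g = 0"
  proof -
    have "integral {x1..x2} ?g = integral {x1..x2} (\<lambda>x. 0)"
      by (rule integral_spike[OF negligible_base_fiber[of b z]]) simp
    then show ?thesis by simp
  qed
  ultimately show ?thesis by simp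
qed

text \<open>The distance is the ambient one between points of the surface, so the function is
  periodic for \<open>Circle\<close> and vanishes around all preimages of \<open>v\<close> at once;
  squaring removes the singularity at the centre. The transition takes place where the square of
  \<open>n * dist\<close> lies between 1 and 2.\<close>

definition cutoff :: "base_curve \<Rightarrow> complex \<times> real \<Rightarrow> nat \<Rightarrow> real \<times> real \<Rightarrow> real" where
  "cutoff b v n p = step ((real n)\<^sup>2 * (dist (pt b p) v)\<^sup>2 - 1)"

text \<open>The gradient has size O(n) and is supported at distance below 2/n. The bound is split
  into an indicator in t and a continuous hat in x that is at least 1 on the support, so that the
  variables can be integrated one after the other.\<close>

lemma cutoff_derivative:
  assumes "n > 0"
  shows "C1 (cutoff b v n) UNIV"
    and "\<bar>frechet_derivative (cutoff b v n) (at (x, t)) (1, 0)\<bar> + \<bar>frechet_derivative (cutoff b v n) (at (x, t)) (0, 1)\<bar>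
      \<le> (if t \<in> {snd v - 2 / real n..snd v + 2 / real n} then 16 * real n * max 0 (3 - real n * norm (base_pt b x - fst v)) else 0)"
proof -
  let ?N = "\<lambda>p. (dist (pt b p) v)\<^sup>2"
  obtain z s where v: "v = (z, s)" by (cases v)
  obtain d where d: "\<And>x. ((\<lambda>x. (norm (base_pt b x - z))\<^sup>2) has_real_derivative d x) (at x)"
    and d_le: "\<And>x. \<bar>d x\<bar> \<le> 2 * norm (base_pt b x - z)" and d_cont: "\<And>S. continuous_on S d"
    by (rule base_dist_derivative[of b z]) blast
  have N: "?N p = (norm (base_pt b (fst p) - z))\<^sup>2 + (snd p - s)\<^sup>2" for p
    by (simp add: v pt_def dist_Pair_Pair) (simp add: dist_norm)
  have C1_N: "C1 ?N UNIV"
    unfolding N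
    by (intro C1_add C1_power2 C1_diff C1_snd C1_const C1_compose[OF C1_fst d d_cont])
  then have C1_arg: "C1 (\<lambda>p. (real n)\<^sup>2 * ?N p - 1) UNIV"
    by (intro C1_diff C1_mult C1_const)
  then show "C1 (cutoff b v n) UNIV"
    unfolding cutoff_def[abs_def] by (rule C1_step)
  define p where "p = (x, t)"
  let ?D = "norm (base_pt b x - z)"
  let ?\<sigma> = "step' ((real n)\<^sup>2 * ?N p - 1)"
  have b: "((\<lambda>q. (norm (base_pt b (fst q) - z))\<^sup>2) has_derivative (\<lambda>h. d x * fst h)) (at p)"
    using has_derivative_compose[of fst fst p UNIV "\<lambda>x. (norm (base_pt b x - z))\<^sup>2" "(*) (d x)"] d[of x]
    by (simp add: p_def has_field_derivative_def has_derivative_fst[OF has_derivative_ident])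
  have a: "((\<lambda>p. (real n)\<^sup>2 * ?N p - 1) has_derivative
      (\<lambda>h. (real n)\<^sup>2 * (d x * fst h + 2 * (t - s) * snd h))) (at p)"
    unfolding N power2_eq_square[of "snd _ - s"]
    by (rule derivative_eq_intros b refl)+ (simp add: p_def fun_eq_iff algebra_simps)
  have "frechet_derivative (cutoff b v n) (at p) h = ?\<sigma> * ((real n)\<^sup>2 * (d x * fst h + 2 * (t - s) * snd h))" for h
    unfolding cutoff_def[abs_def] frechet_derivative_comp_real[OF differentiableI[OF a] DERIV_step]
    using fun_cong[OF frechet_derivative_at[OF a], of h] by simp
  then have "\<bar>frechet_derivative (cutoff b v n) (at p) (1, 0)\<bar> + \<bar>frechet_derivative (cutoff b v n) (at p) (0, 1)\<bar>
      = \<bar>?\<sigma>\<bar> * ((real n)\<^sup>2 * \<bar>d x\<bar>) + \<bar>?\<sigma>\<bar> * ((real n)\<^sup>2 * (2 * \<bar>t - s\<bar>))"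
    by (simp only: abs_mult fst_conv snd_conv mult_1_right mult_zero_right add_0_left add_0_right abs_numeral abs_power2)
  also have "\<dots> = ?\<sigma> * (real n)\<^sup>2 * (\<bar>d x\<bar> + 2 * \<bar>t - s\<bar>)"
    using step'_nonneg[of "(real n)\<^sup>2 * ?N p - 1"] by (simp add: distrib_left)
  also have "\<dots> \<le> (if t \<in> {s - 2 / real n..s + 2 / real n} then 16 * real n * max 0 (3 - real n * ?D) else 0)"
  proof (cases "(real n)\<^sup>2 * ?N p < 2")
    case False
    then show ?thesis by (simp add: step'_outside)
  next
    case True
    have "(real n * ?D)\<^sup>2 + (real n * \<bar>t - s\<bar>)\<^sup>2 < 2"
      using True by (simp add: N p_def power_mult_distrib distrib_left)
    then have "(real n * ?D)\<^sup>2 < 2\<^sup>2" "(real n * \<bar>t - s\<bar>)\<^sup>2 < 2\<^sup>2"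
      using zero_le_power2[of "real n * ?D"] zero_le_power2[of "real n * \<bar>t - s\<bar>"]
      unfolding power2_eq_square[of "2 :: real"] by linarith+
    then have D: "real n * ?D < 2" and t: "real n * \<bar>t - s\<bar> < 2"
      by (auto intro: power2_less_imp_less)
    have "\<bar>t - s\<bar> \<le> 2 / real n"
      using t assms by (simp add: field_simps)
    then have t': "t \<in> {s - 2 / real n..s + 2 / real n}" by auto
    have "real n * (\<bar>d x\<bar> + 2 * \<bar>t - s\<bar>) \<le> real n * (2 * ?D + 2 * \<bar>t - s\<bar>)"
      using d_le[of x] by (intro mult_left_mono) auto
    also have "\<dots> \<le> 8" using D t by (simp add: algebra_simps)
    \<comment> \<open>The 16 is the bound 2 for \<open>step'\<close> times the 8 just obtained; the
      hat is at least 1 here because \<open>real n * ?D < 2\<close>.\<close>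
    finally have "?\<sigma> * (real n * (real n * (\<bar>d x\<bar> + 2 * \<bar>t - s\<bar>))) \<le> 2 * (real n * 8)"
      by (intro mult_mono step'_le_2 mult_left_mono) auto
    also have "\<dots> \<le> 16 * real n * max 0 (3 - real n * ?D)"
      using mult_left_mono[of 1 "max 0 (3 - real n * ?D)" "16 * real n"] D by simp
    finally show ?thesis using t' by (simp add: power2_eq_square mult.assoc)
  qed
  finally show "\<bar>frechet_derivative (cutoff b v n) (at (x, t)) (1, 0)\<bar> + \<bar>frechet_derivative (cutoff b v n) (at (x, t)) (0, 1)\<bar>
      \<le> (if t \<in> {snd v - 2 / real n..snd v + 2 / real n} then 16 * real n * max 0 (3 - real n * norm (base_pt b x - fst v)) else 0)"
    by (simp only: v p_def fst_conv snd_conv)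
qed

lemma integral_if_interval_le:
  fixes k :: real
  assumes "k \<ge> 0" "l \<le> h"
  shows "(\<lambda>t. if t \<in> {l..h} then k else 0) integrable_on {t1..t2}"
    and "integral {t1..t2} (\<lambda>t. if t \<in> {l..h} then k else 0) \<le> (h - l) * k"
proof -
  have e: "{l..h} \<inter> {t1..t2} = {max l t1..min h t2}" by auto
  show "(\<lambda>t. if t \<in> {l..h} then k else 0) integrable_on {t1..t2}"
    by (subst integrable_restrict_Int) (simp add: e integrable_const_ivl)
  have "integral {t1..t2} (\<lambda>t. if t \<in> {l..h} then k else 0) = integral ({l..h} \<inter> {t1..t2}) (\<lambda>_. k)"
    by (rule integral_restrict_Int)
  also have "\<dots> \<le> (h - l) * k"
    unfolding e using assms by (auto simp: content_real_if intro: mult_right_mono)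
  finally show "integral {t1..t2} (\<lambda>t. if t \<in> {l..h} then k else 0) \<le> (h - l) * k" .
qed

text \<open>Integration in t over an interval of length 4/n turns \<open>16 * n\<close> into 64, so
  the powers of n cancel and the decay is left to the integral of the hat in x. No count of the
  preimages of \<open>v\<close> in the box enters.\<close>

lemma cutoff_integral_le:
  assumes "n > 0"
  shows "integral (cbox (x1, t1) (x2, t2))
      (\<lambda>p. \<bar>frechet_derivative (cutoff b v n) (at p) (1, 0)\<bar> + \<bar>frechet_derivative (cutoff b v n) (at p) (0, 1)\<bar>)
    \<le> 64 * integral {x1..x2} (\<lambda>x. max 0 (3 - real n * norm (base_pt b x - fst v)))"
    (is "integral ?B ?f \<le> 64 * integral _ ?k")
proof -
  have f: "continuous_on S ?f" for S
    by (intro continuous_intros continuous_on_subset[OF C1_continuous_deriv[OF cutoff_derivative(1)[OF assms]] subset_UNIV])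
  have k: "?k integrable_on {x1..x2}"
    by (intro integrable_continuous_real continuous_intros base_pt_continuous)
  have "integral ?B ?f = integral {x1..x2} (\<lambda>x. integral {t1..t2} (\<lambda>t. ?f (x, t)))"
    using integral_prod_continuous[OF f] by simp
  also have "\<dots> \<le> integral {x1..x2} (\<lambda>x. 64 * ?k x)"
  proof (rule integral_le)
    show "(\<lambda>x. integral {t1..t2} (\<lambda>t. ?f (x, t))) integrable_on {x1..x2}"
      using integral_integrable_2dim[of x1 t1 x2 t2 ?f] f by simp
    show "(\<lambda>x. 64 * ?k x) integrable_on {x1..x2}"
      using integrable_on_cmult_left[OF k, of 64] by simp
    fix x
    let ?l = "snd v - 2 / real n" and ?h = "snd v + 2 / real n"
    have c: "continuous_on {t1..t2} (\<lambda>t. ?f (x, t))"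
      by (rule continuous_on_compose2[OF f]) (auto intro!: continuous_intros)
    have "integral {t1..t2} (\<lambda>t. ?f (x, t)) \<le>
      integral {t1..t2} (\<lambda>t. if t \<in> {?l..?h} then 16 * real n * ?k x else 0)"
      by (rule integral_le[OF integrable_continuous_real[OF c] integral_if_interval_le(1)
            cutoff_derivative(2)[OF assms]]) auto
    also have "\<dots> \<le> (?h - ?l) * (16 * real n * ?k x)"
      by (rule integral_if_interval_le(2)) auto
    also have "\<dots> = 64 * ?k x"
      using assms by simp
    finally show "integral {t1..t2} (\<lambda>t. ?f (x, t)) \<le> 64 * ?k x" .
  qed
  also have "\<dots> = 64 * integral {x1..x2} ?k" by simp
  finally show ?thesis .
qed

lemma cutoff_eq_0:
  assumes "n > 0" "dist (pt b p) v < 1 / n"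
  shows "cutoff b v n p = 0"
proof -
  have "real n * dist (pt b p) v \<le> 1"
    using assms by (simp add: field_simps)
  from power_le_one[OF _ this, of 2] show ?thesis
    by (simp add: cutoff_def step_le_0 power_mult_distrib)
qed

lemma cutoff_eq_1:
  assumes "n > 0" "dist (pt b p) v \<ge> 2 / real n"
  shows "cutoff b v n p = 1"
proof -
  have "real n * dist (pt b p) v \<ge> 2"
    using assms by (simp add: field_simps)
  from power_mono[OF this, of 2] show ?thesis
    by (simp add: cutoff_def step_ge_1 power_mult_distrib)
qed

text \<open>Gradients of size n on discs of radius comparable to 1/n have small L1 norm; in this
  sense points have zero capacity. Induction on \<open>V\<close> multiplies the cutoffs, and as all
  factors lie in [0, 1] the gradient norms at most add.\<close>

lemma ex_cutoff:
  assumes "finite V" "r > 0" "e > 0"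
  shows "\<exists>\<psi>. C1 \<psi> UNIV \<and> (\<forall>p. 0 \<le> \<psi> p \<and> \<psi> p \<le> 1) \<and> (\<forall>p q. pt b p = pt b q \<longrightarrow> \<psi> p = \<psi> q) \<and>
    (\<exists>\<delta>>0. \<forall>v\<in>V. \<forall>p. dist (pt b p) v < \<delta> \<longrightarrow> \<psi> p = 0) \<and>
    (\<forall>p. (\<forall>v\<in>V. dist (pt b p) v \<ge> r) \<longrightarrow> \<psi> p = 1) \<and>
    integral (cbox (x1, t1) (x2, t2))
      (\<lambda>p. \<bar>frechet_derivative \<psi> (at p) (1, 0)\<bar> + \<bar>frechet_derivative \<psi> (at p) (0, 1)\<bar>) \<le> e"
  using assms(1,3)
proof (induction V arbitrary: e)
  case empty
  have "frechet_derivative (\<lambda>_. 1 :: real) (at p) = (\<lambda>_. 0)" for p :: "real \<times> real"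
    using frechet_derivative_at[OF has_derivative_const] by metis
  with empty show ?case
    by (intro exI[of _ "\<lambda>_. 1"]) (auto intro: C1_const exI[of _ 1])
next
  case (insert v V)
  let ?D = "\<lambda>\<psi> p. \<bar>frechet_derivative \<psi> (at p) (1, 0)\<bar> + \<bar>frechet_derivative \<psi> (at p) (0, 1)\<bar>"
  let ?B = "cbox (x1, t1) (x2, t2)"
  have "e / 2 > 0" using insert.prems by simp
  from insert.IH[OF this] obtain \<psi> \<delta> where
    \<psi>: "C1 \<psi> UNIV" "\<And>p. 0 \<le> \<psi> p" "\<And>p. \<psi> p \<le> 1" "\<And>p q. pt b p = pt b q \<Longrightarrow> \<psi> p = \<psi> q"
    "\<delta> > 0" "\<And>v p. v \<in> V \<Longrightarrow> dist (pt b p) v < \<delta> \<Longrightarrow> \<psi> p = 0"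
    "\<And>p. (\<forall>v\<in>V. dist (pt b p) v \<ge> r) \<Longrightarrow> \<psi> p = 1" "integral ?B (?D \<psi>) \<le> e / 2"
    by blast
  \<comment> \<open>Half of \<open>e\<close> is left for the new vertex, and \<open>e / 128\<close>
    allows for the factor 64 in \<open>cutoff_integral_le\<close>. The condition
    \<open>n > 2 / r\<close> makes the new cutoff 1 from distance \<open>r\<close> on.\<close>
  have "\<forall>\<^sub>F n in sequentially. integral {x1..x2} (\<lambda>x. max 0 (3 - real n * norm (base_pt b x - fst v))) < e / 128"
    by (rule order_tendstoD(2)[OF fiber_integral_tendsto_0]) (use insert.prems in simp)
  moreover have "\<forall>\<^sub>F n in sequentially. n > 2 / r"
    using filterlim_real_sequentially by (auto simp: filterlim_at_top_dense)
  ultimately have "\<forall>\<^sub>F n in sequentially. integral {x1..x2} (\<lambda>x. max 0 (3 - real n * norm (base_pt b x - fst v))) < e / 128 \<and> n > 2 / r"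
    by (rule eventually_conj)
  then obtain n :: nat where n: "integral {x1..x2} (\<lambda>x. max 0 (3 - real n * norm (base_pt b x - fst v))) < e / 128"
    "n > 2 / r"
    using eventually_happens'[OF sequentially_bot] by blast
  have "real n > 0" using n(2) \<open>r > 0\<close> by (smt (verit) divide_pos_pos)
  then have n0: "n > 0" by simp
  have nr: "2 / real n < r"
    using n(2) \<open>r > 0\<close> n0 by (simp add: field_simps)
  let ?\<kappa> = "cutoff b v n"
  let ?g = "\<lambda>p. \<psi> p * ?\<kappa> p"
  have \<kappa>: "C1 ?\<kappa> UNIV" by (rule cutoff_derivative(1)[OF n0])
  have \<kappa>01: "0 \<le> ?\<kappa> p" "?\<kappa> p \<le> 1" for p
    by (simp_all add: cutoff_def step_nonneg step_le_1)
  have C: "C1 ?g UNIV" by (intro C1_mult \<psi> \<kappa>)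
  have cD: "continuous_on ?B (?D f)" if "C1 f UNIV" for f
    by (intro continuous_intros continuous_on_subset[OF C1_continuous_deriv[OF that] subset_UNIV])
  have one: "\<bar>frechet_derivative ?g (at p) h\<bar> \<le> \<bar>frechet_derivative \<psi> (at p) h\<bar> + \<bar>frechet_derivative ?\<kappa> (at p) h\<bar>" for p h
  proof -
    have "\<bar>frechet_derivative ?g (at p) h\<bar> \<le> \<bar>\<psi> p * frechet_derivative ?\<kappa> (at p) h\<bar> + \<bar>frechet_derivative \<psi> (at p) h * ?\<kappa> p\<bar>"
      by (subst frechet_derivative_mult) (use \<psi>(1) \<kappa> in \<open>simp_all only: C1_def UNIV_I abs_triangle_ineq\<close>)
    also have "\<dots> \<le> 1 * \<bar>frechet_derivative ?\<kappa> (at p) h\<bar> + \<bar>frechet_derivative \<psi> (at p) h\<bar> * 1"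
      unfolding abs_mult using \<psi>(2,3)[of p] \<kappa>01[of p] by (intro add_mono mult_mono) auto
    finally show ?thesis by simp
  qed
  have "integral ?B (?D ?g) \<le> integral ?B (\<lambda>p. ?D \<psi> p + ?D ?\<kappa> p)"
  proof (rule integral_le)
    show "?D ?g p \<le> ?D \<psi> p + ?D ?\<kappa> p" for p
      using one[of p "(1, 0)"] one[of p "(0, 1)"] by linarith
  qed (intro integrable_continuous cD C \<psi> \<kappa> continuous_on_add)+
  also have "\<dots> = integral ?B (?D \<psi>) + integral ?B (?D ?\<kappa>)"
    by (intro integral_add integrable_continuous cD \<psi> \<kappa>)
  also have "\<dots> \<le> e"
    using \<psi>(8) cutoff_integral_le[OF n0, of x1 t1 x2 t2 b v] n(1) by simp
  finally have int: "integral ?B (?D ?g) \<le> e" .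
  show ?case
  proof (intro exI[of _ ?g] conjI allI impI)
    show "C1 ?g UNIV" by (rule C)
    show "0 \<le> ?g p" "?g p \<le> 1" for p
      using \<psi>(2,3) \<kappa>01 by (simp_all add: mult_le_one)
    show "?g p = ?g q" if "pt b p = pt b q" for p q
      using \<psi>(4)[OF that] that by (simp add: cutoff_def)
    show "\<exists>\<delta>>0. \<forall>v\<in>insert v V. \<forall>p. dist (pt b p) v < \<delta> \<longrightarrow> ?g p = 0"
      using \<psi>(5,6) n0 cutoff_eq_0[OF n0]
      by (intro exI[of _ "min \<delta> (1 / n)"]) auto
    show "?g p = 1" if "\<forall>v\<in>insert v V. dist (pt b p) v \<ge> r" for p
      using that nr \<psi>(7)[of p] cutoff_eq_1[OF n0, of b p v] by auto
    show "integral ?B (?D ?g) \<le> e" by (rule int)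
  qed
qed

section \<open>The energy estimate\<close>

text \<open>The shifts place the transitions where \<open>u1 - u2\<close> is in
  [\<epsilon>, 2\<epsilon>], \<open>u2\<close> in [K, 2K] and \<open>u1\<close> in
  [-2K, -K].\<close>

definition test_fun :: "real \<Rightarrow> real \<Rightarrow> (real \<times> real \<Rightarrow> real) \<Rightarrow> (real \<times> real \<Rightarrow> real) \<Rightarrow>
    (real \<times> real \<Rightarrow> real) \<Rightarrow> real \<times> real \<Rightarrow> real" where
  "test_fun \<epsilon> K u1 u2 \<psi> p = step ((u1 p - u2 p) / \<epsilon> - 1) * (1 - step (u2 p / K - 1)) * step (u1 p / K + 2) * \<psi> p"

lemma C1_test_fun:
  assumes "C1 u1 U" "C1 u2 U" "C1 \<psi> U" "\<epsilon> > 0" "K > 0"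
  shows "C1 (test_fun \<epsilon> K u1 u2 \<psi>) U"
  unfolding test_fun_def[abs_def]
  by (intro C1_mult C1_diff C1_step C1_add C1_divide C1_const assms)
    (use assms in auto)

lemma test_fun_derivative:
  assumes "u1 differentiable (at p)" "u2 differentiable (at p)" "\<psi> differentiable (at p)" "\<epsilon> > 0" "K > 0"
  defines "T \<equiv> step ((u1 p - u2 p) / \<epsilon> - 1)" and "T' \<equiv> step' ((u1 p - u2 p) / \<epsilon> - 1)"
    and "A \<equiv> 1 - step (u2 p / K - 1)" and "A' \<equiv> step' (u2 p / K - 1)"
    and "B \<equiv> step (u1 p / K + 2)" and "B' \<equiv> step' (u1 p / K + 2)"
  shows "frechet_derivative (test_fun \<epsilon> K u1 u2 \<psi>) (at p) v =
    T' / \<epsilon> * A * B * \<psi> p * (frechet_derivative u1 (at p) v - frechet_derivative u2 (at p) v)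
    - T * A' / K * B * \<psi> p * frechet_derivative u2 (at p) v
    + T * A * B' / K * \<psi> p * frechet_derivative u1 (at p) v
    + T * A * B * frechet_derivative \<psi> (at p) v"
proof -
  let ?D = "\<lambda>f. frechet_derivative f (at p)"
  have stepD: "((\<lambda>q. step (f q)) has_derivative (\<lambda>v. step' (f p) * f' v)) (at p)"
    if "(f has_derivative f') (at p)" for f f' :: "real \<times> real \<Rightarrow> real"
    using has_derivative_compose[OF that, of step "(*) (step' (f p))"] DERIV_step[of "f p"]
    by (simp add: has_field_derivative_def)
  have u: "(u1 has_derivative ?D u1) (at p)" "(u2 has_derivative ?D u2) (at p)" "(\<psi> has_derivative ?D \<psi>) (at p)"
    using assms(1-3) by (simp_all only: frechet_derivative_works)
  have "((\<lambda>q. (u1 q - u2 q) / \<epsilon> - 1) has_derivative (\<lambda>v. (?D u1 v - ?D u2 v) / \<epsilon>)) (at p)"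
    "((\<lambda>q. u2 q / K - 1) has_derivative (\<lambda>v. ?D u2 v / K)) (at p)"
    "((\<lambda>q. u1 q / K + 2) has_derivative (\<lambda>v. ?D u1 v / K)) (at p)"
    using \<open>\<epsilon> > 0\<close> \<open>K > 0\<close> by (auto intro!: derivative_eq_intros u)
  note s = this[THEN stepD, folded T'_def A'_def B'_def]
  have "(test_fun \<epsilon> K u1 u2 \<psi> has_derivative
    (\<lambda>v. ((T * A) * (B' * (?D u1 v / K)) + (T * (0 - A' * (?D u2 v / K)) + T' * ((?D u1 v - ?D u2 v) / \<epsilon>) * A) * B) * \<psi> p
      + T * A * B * ?D \<psi> v)) (at p)"
    unfolding test_fun_def[abs_def] T_def A_def B_def
    by (rule has_derivative_eq_rhs[OF has_derivative_mult[OF has_derivative_mult[OF has_derivative_mult[OF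
        s(1) has_derivative_diff[OF has_derivative_const s(2)]] s(3)] u(3)]])
      (simp add: fun_eq_iff add.commute)
  from fun_cong[OF frechet_derivative_at[OF this], of v] show ?thesis
    by (simp add: algebra_simps diff_divide_distrib)
qed

text \<open>In the product rule the derivatives of the two truncations carry coefficients between 0
  and 2/K. The truncation in \<open>u2\<close> enters with a minus sign and meets
  \<open>E u2 \<le> 1\<close>, the one in \<open>u1\<close> with a plus sign and meets
  \<open>E u1 \<ge> -1\<close>; together they cost at most 4/K. The cutoff term is controlled by the
  flux bounds, with a factor 2 for the difference of two fluxes.\<close>

lemma test_fun_pairing_ge:
  fixes u1 u2 \<psi> \<alpha> \<beta> :: "real \<times> real \<Rightarrow> real"
  assumes "u1 differentiable (at p)" "u2 differentiable (at p)" "\<psi> differentiable (at p)" "\<epsilon> > 0" "K > 0"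
    and \<psi>: "0 \<le> \<psi> p" "\<psi> p \<le> 1"
  defines "X \<equiv> flux_x \<alpha> \<beta> u1 p - flux_x \<alpha> \<beta> u2 p" and "Y \<equiv> flux_t \<alpha> \<beta> u1 p - flux_t \<alpha> \<beta> u2 p"
  defines "E \<equiv> \<lambda>u. X * frechet_derivative u (at p) (1, 0) + Y * frechet_derivative u (at p) (0, 1)"
  shows "E (test_fun \<epsilon> K u1 u2 \<psi>) \<ge>
    step' ((u1 p - u2 p) / \<epsilon> - 1) / \<epsilon> * (1 - step (u2 p / K - 1)) * step (u1 p / K + 2) * \<psi> p * (E u1 - E u2)
    - 4 / K - 2 * (\<bar>\<alpha> p\<bar> * \<bar>frechet_derivative \<psi> (at p) (1, 0)\<bar> + \<bar>\<beta> p\<bar> * \<bar>frechet_derivative \<psi> (at p) (0, 1)\<bar>)"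
proof -
  interpret gradients \<alpha> \<beta> u1 u2 p .
  let ?D = "\<lambda>f. frechet_derivative f (at p)"
  define T T' A A' B B' where
    d: "T = step ((u1 p - u2 p) / \<epsilon> - 1)" "T' = step' ((u1 p - u2 p) / \<epsilon> - 1)"
      "A = 1 - step (u2 p / K - 1)" "A' = step' (u2 p / K - 1)"
      "B = step (u1 p / K + 2)" "B' = step' (u1 p / K + 2)"
  have T: "0 \<le> T" "T \<le> 1" "0 \<le> A" "A \<le> 1" "0 \<le> A'" "A' \<le> 2" "0 \<le> B" "B \<le> 1" "0 \<le> B'" "B' \<le> 2"
    by (simp_all add: d step_nonneg step_le_1 step'_nonneg step'_le_2)
  have E1: "E u1 \<ge> -1" and E2: "E u2 \<le> 1"
    using pairing_ge pairing_le by (simp_all add: E_def X_def Y_def)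
  have eq: "E (test_fun \<epsilon> K u1 u2 \<psi>) = T' / \<epsilon> * A * B * \<psi> p * (E u1 - E u2)
     - (T * B * \<psi> p * A') / K * E u2 + (T * A * \<psi> p * B') / K * E u1 + T * A * B * E \<psi>"
    unfolding E_def test_fun_derivative[OF assms(1-5)] d[symmetric]
    by (simp add: algebra_simps diff_divide_distrib add_divide_distrib)
  have le2: "0 \<le> t * a * b * c" "t * a * b * c \<le> 2" if "0 \<le> t" "t \<le> 1" "0 \<le> a" "a \<le> 1" "0 \<le> b" "b \<le> 1" "0 \<le> c" "c \<le> 2"
    for t a b c :: real
  proof -
    have "t * a * b \<le> 1" using that by (simp add: mult_le_one)
    from mult_mono[OF this that(8)] show "t * a * b * c \<le> 2" using that by simp
    show "0 \<le> t * a * b * c" using that by simp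
  qed
  have "(T * B * \<psi> p * A') / K * E u2 \<le> (T * B * \<psi> p * A') / K * 1"
    using le2[of T B "\<psi> p" A'] T \<psi> E2 \<open>K > 0\<close> by (intro mult_left_mono) auto
  also have "\<dots> \<le> 2 / K"
    using le2[of T B "\<psi> p" A'] T \<psi> \<open>K > 0\<close> by (simp add: divide_right_mono)
  finally have 2: "(T * B * \<psi> p * A') / K * E u2 \<le> 2 / K" .
  have "(T * A * \<psi> p * B') / K * (- E u1) \<le> (T * A * \<psi> p * B') / K * 1"
    using le2[of T A "\<psi> p" B'] T \<psi> E1 \<open>K > 0\<close> by (intro mult_left_mono) auto
  also have "\<dots> \<le> 2 / K"
    using le2[of T A "\<psi> p" B'] T \<psi> \<open>K > 0\<close> by (simp add: divide_right_mono)
  finally have 1: "(T * A * \<psi> p * B') / K * E u1 \<ge> - (2 / K)" by simp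
  have "\<bar>X\<bar> \<le> 2 * \<bar>\<alpha> p\<bar>" "\<bar>Y\<bar> \<le> 2 * \<bar>\<beta> p\<bar>"
    using flux_x_bound[of \<alpha> \<beta> u1 p] flux_x_bound[of \<alpha> \<beta> u2 p] flux_t_bound[of \<alpha> \<beta> u1 p] flux_t_bound[of \<alpha> \<beta> u2 p]
    unfolding X_def Y_def by linarith+
  then have "\<bar>X * ?D \<psi> (1, 0)\<bar> \<le> 2 * \<bar>\<alpha> p\<bar> * \<bar>?D \<psi> (1, 0)\<bar>" "\<bar>Y * ?D \<psi> (0, 1)\<bar> \<le> 2 * \<bar>\<beta> p\<bar> * \<bar>?D \<psi> (0, 1)\<bar>"
    unfolding abs_mult by (intro mult_right_mono; simp)+
  then have E\<psi>: "\<bar>E \<psi>\<bar> \<le> 2 * (\<bar>\<alpha> p\<bar> * \<bar>?D \<psi> (1, 0)\<bar> + \<bar>\<beta> p\<bar> * \<bar>?D \<psi> (0, 1)\<bar>)"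
    unfolding E_def distrib_left mult.assoc by linarith
  have "\<bar>T * A * B\<bar> \<le> 1" using T by (simp add: mult_le_one)
  from mult_mono[OF this E\<psi>] have "\<bar>T * A * B * E \<psi>\<bar> \<le> 2 * (\<bar>\<alpha> p\<bar> * \<bar>?D \<psi> (1, 0)\<bar> + \<bar>\<beta> p\<bar> * \<bar>?D \<psi> (0, 1)\<bar>)"
    by (simp add: abs_mult)
  then show ?thesis
    unfolding eq d[symmetric] using 1 2 by linarith
qed

text \<open>The weak form of the equation for the difference, tested with \<open>test_fun\<close>:
  the divergence of \<open>\<zeta> \<mu> (X, Y)\<close> integrates to 0, and as
  \<open>\<mu> (X, Y)\<close> is divergence free only \<open>\<mu> E \<zeta>\<close> is left. Of the
  nonnegative main term only the share of the small box \<open>cbox l h\<close> is kept, where both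
  truncations and the cutoff equal 1. The alternatives in \<open>sides\<close> cover sides missed by
  the domain and, on the circle, sides identified by periodicity.\<close>

lemma energy_estimate:
  fixes u1 u2 \<alpha> \<beta> \<mu> \<psi> :: "real \<times> real \<Rightarrow> real"
  defines "X \<equiv> \<lambda>p. flux_x \<alpha> \<beta> u1 p - flux_x \<alpha> \<beta> u2 p" and "Y \<equiv> \<lambda>p. flux_t \<alpha> \<beta> u1 p - flux_t \<alpha> \<beta> u2 p"
  defines "E \<equiv> \<lambda>u p. X p * frechet_derivative u (at p) (1, 0) + Y p * frechet_derivative u (at p) (0, 1)"
  assumes "open U"
    and \<mu>: "C1 \<mu> UNIV" "\<And>p. \<mu> p > 0"
    and \<alpha>\<beta>: "continuous_on UNIV \<alpha>" "continuous_on UNIV \<beta>"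
    and u: "C1 u1 U" "C1 u2 U" "C1 (flux_x \<alpha> \<beta> u1) U" "C1 (flux_x \<alpha> \<beta> u2) U"
      "C1 (flux_t \<alpha> \<beta> u1) U" "C1 (flux_t \<alpha> \<beta> u2) U"
    and conservation: "\<And>p u. p \<in> U \<Longrightarrow> u \<in> {u1, u2} \<Longrightarrow>
      frechet_derivative (\<lambda>q. \<mu> q * flux_x \<alpha> \<beta> u q) (at p) (1, 0) +
      frechet_derivative (\<lambda>q. \<mu> q * flux_t \<alpha> \<beta> u q) (at p) (0, 1) = 0"
    and \<psi>: "C1 \<psi> UNIV" "\<And>p. 0 \<le> \<psi> p" "\<And>p. \<psi> p \<le> 1"
    and "\<epsilon> > 0" "K > 0"
    and zero: "\<And>p. p \<notin> U \<Longrightarrow> \<exists>N. open N \<and> p \<in> N \<and> (\<forall>q\<in>N \<inter> U. test_fun \<epsilon> K u1 u2 \<psi> q = 0)"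
    and box: "x1 \<le> x2" "t1 \<le> t2"
    and sides: "\<And>t. ((x1, t) \<notin> U \<and> (x2, t) \<notin> U) \<or>
      ((x1, t) \<in> U \<and> (x2, t) \<in> U \<and>
       test_fun \<epsilon> K u1 u2 \<psi> (x1, t) * (\<mu> (x1, t) * X (x1, t)) = test_fun \<epsilon> K u1 u2 \<psi> (x2, t) * (\<mu> (x2, t) * X (x2, t)))"
    and ends: "\<And>x. (x, t1) \<notin> U \<and> (x, t2) \<notin> U"
    and S: "cbox l h \<subseteq> U" "cbox l h \<subseteq> cbox (x1, t1) (x2, t2)" "\<eta> \<ge> 0"
    and low: "\<And>p. p \<in> cbox l h \<Longrightarrow>
      u2 p \<le> K \<and> u1 p \<ge> - K \<and> \<psi> p = 1 \<and> \<eta> \<le> \<mu> p * (step' ((u1 p - u2 p) / \<epsilon> - 1) / \<epsilon> * (E u1 p - E u2 p))"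
  shows "\<eta> * measure lborel (cbox l h) \<le> integral (cbox (x1, t1) (x2, t2))
    (\<lambda>p. \<mu> p * (4 / K + 2 * (\<bar>\<alpha> p\<bar> * \<bar>frechet_derivative \<psi> (at p) (1, 0)\<bar> + \<bar>\<beta> p\<bar> * \<bar>frechet_derivative \<psi> (at p) (0, 1)\<bar>)))"
proof -
  let ?\<zeta> = "test_fun \<epsilon> K u1 u2 \<psi>" and ?B = "cbox (x1, t1) (x2, t2)"
  let ?err = "\<lambda>p. \<mu> p * (4 / K + 2 * (\<bar>\<alpha> p\<bar> * \<bar>frechet_derivative \<psi> (at p) (1, 0)\<bar> + \<bar>\<beta> p\<bar> * \<bar>frechet_derivative \<psi> (at p) (0, 1)\<bar>))"
  have \<psi>U: "C1 \<psi> U" and \<mu>U: "C1 \<mu> U" using \<psi>(1) \<mu>(1) by (auto intro: C1_subset)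
  have X: "C1 X U" and Y: "C1 Y U" unfolding X_def Y_def by (intro C1_diff u)+
  have \<zeta>: "C1 ?\<zeta> U" by (intro C1_test_fun u \<psi>U \<open>\<epsilon> > 0\<close> \<open>K > 0\<close>)
  define P Q where "P = (\<lambda>p. if p \<in> U then ?\<zeta> p * (\<mu> p * X p) else 0)"
    and "Q = (\<lambda>p. if p \<in> U then ?\<zeta> p * (\<mu> p * Y p) else 0)"
  have zP: "\<forall>p. p \<notin> U \<longrightarrow> (\<exists>N. open N \<and> p \<in> N \<and> (\<forall>q\<in>N \<inter> U. ?\<zeta> q * (\<mu> q * X q) = 0))"
    using zero by (metis mult_zero_left)
  have zQ: "\<forall>p. p \<notin> U \<longrightarrow> (\<exists>N. open N \<and> p \<in> N \<and> (\<forall>q\<in>N \<inter> U. ?\<zeta> q * (\<mu> q * Y q) = 0))"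
    using zero by (metis mult_zero_left)
  note P = C1_extend_zero[OF \<open>open U\<close> C1_mult[OF \<zeta> C1_mult[OF \<mu>U X]] zP, folded P_def]
  note Q = C1_extend_zero[OF \<open>open U\<close> C1_mult[OF \<zeta> C1_mult[OF \<mu>U Y]] zQ, folded Q_def]
  let ?F = "\<lambda>p. frechet_derivative P (at p) (1, 0) + frechet_derivative Q (at p) (0, 1)"
  have int0: "integral ?B ?F = 0"
  proof (rule divergence_box[OF P(1) Q(1) box])
    show "P (x1, t) = P (x2, t)" for t using sides[of t] by (auto simp: P_def)
    show "Q (x, t1) = Q (x, t2)" for x using ends[of x] by (simp add: Q_def)
  qed
  have F: "?F p = \<mu> p * E ?\<zeta> p" if p: "p \<in> U" for p
  proof -
    have dif: "f differentiable (at p)" if "C1 f U" for f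
      using that p by (simp add: C1_def)
    note D = frechet_derivative_mult[OF dif[OF \<zeta>] dif[OF C1_mult[OF \<mu>U X]]]
      frechet_derivative_mult[OF dif[OF \<zeta>] dif[OF C1_mult[OF \<mu>U Y]]]
    have "frechet_derivative (\<lambda>q. \<mu> q * X q) (at p) (1, 0) + frechet_derivative (\<lambda>q. \<mu> q * Y q) (at p) (0, 1) = 0"
      unfolding X_def Y_def right_diff_distrib
        frechet_derivative_diff[OF dif[OF C1_mult[OF \<mu>U u(3)]] dif[OF C1_mult[OF \<mu>U u(4)]]]
        frechet_derivative_diff[OF dif[OF C1_mult[OF \<mu>U u(5)]] dif[OF C1_mult[OF \<mu>U u(6)]]]
      using conservation[OF p, of u1] conservation[OF p, of u2] by simp
    then have "?\<zeta> p * frechet_derivative (\<lambda>q. \<mu> q * X q) (at p) (1, 0) + ?\<zeta> p * frechet_derivative (\<lambda>q. \<mu> q * Y q) (at p) (0, 1) = 0"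
      by (simp flip: distrib_left)
    then show ?thesis
      unfolding P(2)[OF p] Q(2)[OF p] D E_def by (simp add: algebra_simps)
  qed
  have E_nn: "0 \<le> E u1 p - E u2 p" for p
    using gradients.pairing_diff_nonneg[of \<alpha> \<beta> u1 p u2] by (simp add: E_def X_def Y_def)
  have err_nn: "?err p \<ge> 0" for p
    using \<mu>(2)[of p] \<open>K > 0\<close> by (intro mult_nonneg_nonneg add_nonneg_nonneg) auto
  \<comment> \<open>Off \<open>U\<close> both extended fields have derivative 0; inside
    \<open>U\<close> but off the small box the main term is dropped as nonnegative.\<close>
  have pt: "(if p \<in> cbox l h then \<eta> else 0) \<le> ?F p + ?err p" for p
  proof (cases "p \<in> U")
    case False
    then have "?F p = 0" by (simp add: P(3) Q(3))
    then show ?thesis using err_nn[of p] False S(1) by auto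
  next
    case True
    let ?G = "step' ((u1 p - u2 p) / \<epsilon> - 1) / \<epsilon> * (1 - step (u2 p / K - 1)) * step (u1 p / K + 2) * \<psi> p * (E u1 p - E u2 p)"
    have "E ?\<zeta> p \<ge> ?G - 4 / K - 2 * (\<bar>\<alpha> p\<bar> * \<bar>frechet_derivative \<psi> (at p) (1, 0)\<bar> + \<bar>\<beta> p\<bar> * \<bar>frechet_derivative \<psi> (at p) (0, 1)\<bar>)"
      using test_fun_pairing_ge[of u1 p u2 \<psi> \<epsilon> K \<alpha> \<beta>] u(1,2) \<psi>U \<psi> True \<open>\<epsilon> > 0\<close> \<open>K > 0\<close>
      by (simp only: C1_def E_def X_def Y_def)
    then have "\<mu> p * (?G - 4 / K - 2 * (\<bar>\<alpha> p\<bar> * \<bar>frechet_derivative \<psi> (at p) (1, 0)\<bar> + \<bar>\<beta> p\<bar> * \<bar>frechet_derivative \<psi> (at p) (0, 1)\<bar>)) \<le> \<mu> p * E ?\<zeta> p"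
      using \<mu>(2)[of p] by (intro mult_left_mono) auto
    then have "\<mu> p * ?G \<le> ?F p + ?err p"
      unfolding F[OF True] by (simp add: algebra_simps)
    moreover have "\<mu> p * ?G \<ge> 0"
      using \<mu>(2)[of p] \<psi>(2)[of p] E_nn[of p] \<open>\<epsilon> > 0\<close> step_le_1[of "u2 p / K - 1"]
      by (intro mult_nonneg_nonneg) (auto simp: step_nonneg step'_nonneg)
    moreover have "\<eta> \<le> \<mu> p * ?G" if "p \<in> cbox l h"
    proof -
      have "step (u2 p / K - 1) = 0" "step (u1 p / K + 2) = 1"
        using low[OF that] \<open>K > 0\<close> by (auto intro!: step_le_0 step_ge_1 simp: field_simps)
      then show ?thesis using low[OF that] by simp
    qed
    ultimately show ?thesis by auto
  qed
  have F_cont: "continuous_on ?B ?F"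
    by (intro continuous_on_add; rule continuous_on_subset[OF C1_continuous_deriv subset_UNIV], rule P Q)
  have err_cont: "continuous_on ?B ?err"
    by (intro continuous_intros continuous_on_subset[OF C1_continuous_deriv[OF \<psi>(1)] subset_UNIV]
        continuous_on_subset[OF C1_continuous[OF \<mu>(1)] subset_UNIV]
        continuous_on_subset[OF \<alpha>\<beta>(1) subset_UNIV] continuous_on_subset[OF \<alpha>\<beta>(2) subset_UNIV])
  have res: "((\<lambda>p. if p \<in> cbox l h then \<eta> else 0) has_integral \<eta> * measure lborel (cbox l h)) ?B"
  proof -
    have "((\<lambda>p. \<eta>) has_integral measure lborel (cbox l h) *\<^sub>R \<eta>) (cbox l h)"
      by (rule has_integral_const)
    then show ?thesis
      using has_integral_restrict[OF S(2), of "\<lambda>_. \<eta>"] by (simp add: mult.commute)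
  qed
  have "\<eta> * measure lborel (cbox l h) \<le> integral ?B (\<lambda>p. ?F p + ?err p)"
    by (rule has_integral_le[OF res integrable_integral[OF integrable_add]])
      (intro integrable_continuous F_cont err_cont pt)+
  also have "\<dots> = integral ?B ?err"
    using integral_add[OF integrable_continuous[OF F_cont] integrable_continuous[OF err_cont]] int0 by simp
  finally show ?thesis .
qed

section \<open>Comparison of two solutions\<close>

lemma frechet_derivative_translate:
  fixes F :: "real \<times> real \<Rightarrow> real"
  assumes "F differentiable (at p)" "\<And>q. F (q + \<tau>) = F q"
  shows "frechet_derivative F (at (p + \<tau>)) = frechet_derivative F (at p)"
proof -
  have "((\<lambda>q. q - \<tau>) has_derivative (\<lambda>h. h)) (at (p + \<tau>))"
    by (auto intro!: derivative_eq_intros)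
  from has_derivative_compose[OF this, of F "frechet_derivative F (at p)"]
  have "((\<lambda>q. F (q - \<tau>)) has_derivative frechet_derivative F (at p)) (at (p + \<tau>))"
    using assms(1) by (simp add: frechet_derivative_works)
  moreover have "(\<lambda>q. F (q - \<tau>)) = F"
    using assms(2)[of "_ - \<tau>"] by simp
  ultimately show ?thesis
    by (metis frechet_derivative_at)
qed

lemma pt_translate: "pt Circle (q + (2 * pi, 0)) = pt Circle q"
  by (simp add: pt_def complex_eq_iff)

lemma islimpt_boundary: "P \<in> closure \<Omega> \<Longrightarrow> P \<notin> \<Omega> \<Longrightarrow> P islimpt \<Omega>"
  by (simp add: closure_def)

context weights
begin

text \<open>If the monotone quantity were positive at \<open>p0\<close>, it would contribute a fixed
  positive amount on a small box around \<open>p0\<close>, independent of \<open>K\<close> and of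
  the vertex cutoff. Choosing these so that the error is at most half of that amount contradicts
  \<open>energy_estimate\<close>. The alternatives in \<open>bdry\<close> are those under which the
  test function vanishes near a boundary point off \<open>V\<close>.\<close>

lemma gradients_agree:
  assumes \<rho>_pos: "\<And>z. z \<in> base_set b \<Longrightarrow> \<rho> z > 0"
    and \<Omega>: "openin (top_of_set (surf b)) \<Omega>" "bounded \<Omega>"
    and sol: "is_solution b c \<phi> \<rho> \<Omega> u1" "is_solution b c \<phi> \<rho> \<Omega> u2"
    and V: "finite V" "V \<inter> \<Omega> = {}"
    and bdry: "\<And>P. P \<in> surf b \<Longrightarrow> P \<in> closure \<Omega> \<Longrightarrow> P \<notin> \<Omega> \<Longrightarrow> P \<notin> V \<Longrightarrow>
      filterlim u2 at_top (at P within \<Omega>) \<or> filterlim u1 at_bot (at P within \<Omega>) \<or>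
      (\<forall>e>0. \<forall>\<^sub>F Q in at P within \<Omega>. u1 Q - u2 Q < e)"
    and p0: "pt b p0 \<in> \<Omega>" "u1 (pt b p0) > u2 (pt b p0)"
  shows "frechet_derivative (u1 \<circ> pt b) (at p0) v = frechet_derivative (u2 \<circ> pt b) (at p0) v"
proof -
  let ?U = "pt b -` \<Omega>" and ?v1 = "u1 \<circ> pt b" and ?v2 = "u2 \<circ> pt b"
  note C1v = solution_C1(1)[OF sol(1)] solution_C1(1)[OF sol(2)]
  note C1f = solution_C1(2)[OF sol(1)] solution_C1(2)[OF sol(2)] solution_C1(3)[OF sol(1)] solution_C1(3)[OF sol(2)]
  have U: "open ?U" by (rule open_pt_vimage[OF \<Omega>(1)])
  have p0U: "p0 \<in> ?U" using p0 by simp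
  define X Y where "X = (\<lambda>p. flux_x \<alpha> \<beta> ?v1 p - flux_x \<alpha> \<beta> ?v2 p)"
    and "Y = (\<lambda>p. flux_t \<alpha> \<beta> ?v1 p - flux_t \<alpha> \<beta> ?v2 p)"
  define E where "E = (\<lambda>u p. X p * frechet_derivative u (at p) (1, 0) + Y p * frechet_derivative u (at p) (0, 1))"
  \<comment> \<open>The factor 2/3 makes \<open>u1 - u2\<close> equal to 3\<epsilon>/2 at
    \<open>p0\<close>, the middle of the transition interval, where \<open>step'\<close> is
    positive.\<close>
  define \<epsilon> where "\<epsilon> = 2 * (u1 (pt b p0) - u2 (pt b p0)) / 3"
  have \<epsilon>: "\<epsilon> > 0" "(?v1 p0 - ?v2 p0) / \<epsilon> - 1 = 1 / 2"
    using p0(2) by (simp_all add: \<epsilon>_def divide_eq_eq)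
  have "E ?v1 p0 - E ?v2 p0 \<ge> 0"
    using gradients.pairing_diff_nonneg[of \<alpha> \<beta> ?v1 p0 ?v2] by (simp add: E_def X_def Y_def)
  moreover have False if pos: "E ?v1 p0 - E ?v2 p0 > 0"
  proof -
    define G where "G = (\<lambda>p. \<mu> p * (step' ((?v1 p - ?v2 p) / \<epsilon> - 1) / \<epsilon> * (E ?v1 p - E ?v2 p)))"
    have G0: "G p0 > 0"
      unfolding G_def \<epsilon>(2) using pos mass_pos[of p0] \<epsilon>(1) step'_pos[of "1 / 2"] by simp
    have contE: "continuous_on ?U (E u)" if "C1 u ?U" for u
      unfolding E_def X_def Y_def
      by (intro continuous_intros C1_continuous C1f C1_continuous_deriv that)
    have contG: "continuous_on ?U G"
      unfolding G_def
      by (intro continuous_intros continuous_on_compose2[OF continuous_on_step'] contE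
          C1_continuous C1v C1_mass) (use \<epsilon> in auto)

    obtain R where R: "R > 0" "\<And>P. P \<in> \<Omega> \<Longrightarrow> norm P < R"
      using bounded_pos_less[of \<Omega>] \<Omega>(2) by blast
    have Rt: "\<bar>snd p\<bar> < R" if "p \<in> ?U" for p
      using R(2)[of "pt b p"] that norm_snd_le[of "snd p" "base_pt b (fst p)"] by (auto simp: pt_def)
    \<comment> \<open>On the line the box reaches at least \<open>R\<close> to both sides of 0 and
      so covers the domain; on the circle it is exactly one period, centred at \<open>p0\<close> to
      keep that point in the interior.\<close>
    define L where "L = (case b of Line \<Rightarrow> \<bar>fst p0\<bar> + R | Circle \<Rightarrow> pi)"
    have L: "L > 0" using R(1) by (cases b) (simp_all add: L_def add_nonneg_pos)
    define x1 x2 where "x1 = fst p0 - L" and "x2 = fst p0 + L"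
    have box: "x1 \<le> x2" "- R \<le> R" using L R by (auto simp: x1_def x2_def)
    have p0_box: "p0 \<in> box (x1, -R) (x2, R)"
      using L Rt[OF p0U] by (cases p0) (auto simp: x1_def x2_def mem_box Basis_prod_def)

    obtain r where r: "r > 0" "\<And>v. v \<in> V \<Longrightarrow> r \<le> dist (pt b p0) v"
      using finite_set_avoid[OF V(1), of "pt b p0"] p0(1) V(2) by (metis disjoint_iff)
    \<comment> \<open>Here the main term exceeds half its value at \<open>p0\<close>,
      \<open>u2\<close> and \<open>u1\<close> obey the one-sided bounds that \<open>K\<close> has to
      respect, and every point of \<open>V\<close> is at distance at least r/2.\<close>
    let ?N = "(?U \<inter> G -` {G p0 / 2<..}) \<inter> (?U \<inter> ?v2 -` {..<?v2 p0 + 1}) \<inter> (?U \<inter> ?v1 -` {?v1 p0 - 1<..})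
      \<inter> pt b -` ball (pt b p0) (r / 2) \<inter> box (x1, -R) (x2, R)"
    have "open ?N"
      by (intro open_Int continuous_open_preimage contG C1_continuous C1v U open_box open_greaterThan open_lessThan)
        (rule open_vimage[OF open_ball pt_continuous])
    moreover have "p0 \<in> ?N" using p0U p0_box G0 r by simp
    ultimately obtain l h where lh: "cbox l h \<subseteq> ?N" "p0 \<in> box l h" "\<forall>i\<in>Basis. l \<bullet> i < h \<bullet> i"
      by (rule open_contains_cbox)
    define m where "m = measure lborel (cbox l h)"
    have m: "m > 0" unfolding m_def by (rule content_pos_lt[OF lh(3)])
    let ?\<eta> = "G p0 / 2"
    have \<eta>m: "?\<eta> * m > 0" using G0 m by simp

    have \<alpha>\<beta>: "continuous_on UNIV \<alpha>" "continuous_on UNIV \<beta>"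
      by (rule C1_continuous[OF C1_weight_x], rule C1_continuous[OF C1_weight_t])
    let ?B = "cbox (x1, -R) (x2, R)"
    \<comment> \<open>A single bound \<open>M\<close> for this function dominates
      \<open>\<mu>\<close>, \<open>2 \<mu> \<bar>\<alpha>\<bar>\<close> and
      \<open>2 \<mu> \<bar>\<beta>\<bar>\<close>, the three coefficients in the error term.\<close>
    let ?h = "\<lambda>p. \<mu> p * (1 + 2 * \<bar>\<alpha> p\<bar> + 2 * \<bar>\<beta> p\<bar>)"
    have "continuous_on ?B ?h"
      by (intro continuous_intros C1_continuous[OF C1_mass]
          continuous_on_subset[OF \<alpha>\<beta>(1)] continuous_on_subset[OF \<alpha>\<beta>(2)]) auto
    then have "bounded (?h ` ?B)"
      by (intro compact_imp_bounded compact_continuous_image compact_cbox)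
    then obtain M where M: "M > 0" "\<And>p. p \<in> ?B \<Longrightarrow> \<bar>?h p\<bar> \<le> M"
      by (auto simp: bounded_pos)
    define A where "A = measure lborel ?B"
    have A: "A \<ge> 0" by (simp add: A_def)
    \<comment> \<open>The first three summands keep both truncations equal to 1 on the small box.
      The last one makes \<open>4 * M * A / K\<close> at most a quarter of
      \<open>?\<eta> * m\<close>; the choice of \<open>e\<close> grants the cutoff another
      quarter.\<close>
    define K where "K = \<bar>?v1 p0\<bar> + \<bar>?v2 p0\<bar> + 1 + 16 * M * A / (?\<eta> * m)"
    have K: "K > 0" "K \<ge> ?v2 p0 + 1" "- K \<le> ?v1 p0 - 1" "K \<ge> 16 * M * A / (?\<eta> * m)"
      using divide_nonneg_pos[OF _ \<eta>m, of "16 * M * A"] M(1) A unfolding K_def by auto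
    define e where "e = ?\<eta> * m / (4 * M)"
    have e: "e > 0" using \<eta>m M by (simp add: e_def)
    have r2: "r / 2 > 0" using r by simp
    from ex_cutoff[OF V(1) r2 e, of b x1 "-R" x2 R] obtain \<psi> \<delta> where
      \<psi>: "C1 \<psi> UNIV" "\<And>p. 0 \<le> \<psi> p" "\<And>p. \<psi> p \<le> 1" "\<And>p q. pt b p = pt b q \<Longrightarrow> \<psi> p = \<psi> q"
      "\<delta> > 0" "\<And>v p. v \<in> V \<Longrightarrow> dist (pt b p) v < \<delta> \<Longrightarrow> \<psi> p = 0"
      "\<And>p. (\<forall>v\<in>V. dist (pt b p) v \<ge> r / 2) \<Longrightarrow> \<psi> p = 1"
      "integral ?B (\<lambda>p. \<bar>frechet_derivative \<psi> (at p) (1, 0)\<bar> + \<bar>frechet_derivative \<psi> (at p) (0, 1)\<bar>) \<le> e"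
      by blast
    let ?D = "\<lambda>p. \<bar>frechet_derivative \<psi> (at p) (1, 0)\<bar> + \<bar>frechet_derivative \<psi> (at p) (0, 1)\<bar>"
    let ?\<zeta> = "test_fun \<epsilon> K ?v1 ?v2 \<psi>"

    have zero: "\<exists>N. open N \<and> p \<in> N \<and> (\<forall>q\<in>N \<inter> ?U. ?\<zeta> q = 0)" if p: "p \<notin> ?U" for p
    proof -
      \<comment> \<open>Vanishing on a punctured neighbourhood in the surface is enough:
        \<open>p\<close> lies over a point outside \<open>\<Omega>\<close>, so the missing centre is
        never met.\<close>
      have *: ?thesis if "\<forall>\<^sub>F Q in at (pt b p) within \<Omega>. \<forall>q. pt b q = Q \<longrightarrow> ?\<zeta> q = 0"
      proof -
        from that obtain S where S: "open S" "pt b p \<in> S"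
          "\<And>Q. Q \<in> S \<Longrightarrow> Q \<noteq> pt b p \<Longrightarrow> Q \<in> \<Omega> \<Longrightarrow> \<forall>q. pt b q = Q \<longrightarrow> ?\<zeta> q = 0"
          by (auto simp: eventually_at_topological)
        show ?thesis
        proof (intro exI[of _ "pt b -` S"] conjI ballI)
          show "open (pt b -` S)" by (rule open_vimage[OF S(1) pt_continuous])
          show "p \<in> pt b -` S" using S(2) by simp
          fix q assume q: "q \<in> pt b -` S \<inter> ?U"
          then have "pt b q \<noteq> pt b p" using p by auto
          then show "?\<zeta> q = 0" using S(3)[of "pt b q"] q by blast
        qed
      qed
      consider "pt b p \<notin> closure \<Omega>" | "pt b p \<in> V" |
        "filterlim u2 at_top (at (pt b p) within \<Omega>)" | "filterlim u1 at_bot (at (pt b p) within \<Omega>)" |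
        "\<forall>\<^sub>F Q in at (pt b p) within \<Omega>. u1 Q - u2 Q < \<epsilon>"
        using bdry[of "pt b p"] p pt_in_surf[of b p] \<epsilon>(1) by auto
      then show ?thesis
      proof cases
        case 1
        then show ?thesis
          using closure_subset[of \<Omega>] open_vimage[OF open_Compl[OF closed_closure] pt_continuous, of b \<Omega>]
          by (intro exI[of _ "pt b -` (- closure \<Omega>)"]) blast
      next
        case 2
        have "open (pt b -` ball (pt b p) \<delta>)" by (rule open_vimage[OF open_ball pt_continuous])
        then show ?thesis
          using \<psi>(5) \<psi>(6)[OF 2]
          by (intro exI[of _ "pt b -` ball (pt b p) \<delta>"] conjI ballI)
            (simp_all add: test_fun_def dist_commute)
      next
        case 3
        then have "\<forall>\<^sub>F Q in at (pt b p) within \<Omega>. u2 Q \<ge> 2 * K"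
          by (simp add: filterlim_at_top)
        then show ?thesis
          by (intro *) (use K(1) in \<open>auto simp: test_fun_def step_ge_1 field_simps elim!: eventually_mono\<close>)
      next
        case 4
        then have "\<forall>\<^sub>F Q in at (pt b p) within \<Omega>. u1 Q \<le> - 2 * K"
          by (simp add: filterlim_at_bot)
        then show ?thesis
          by (intro *) (use K(1) in \<open>auto simp: test_fun_def step_le_0 field_simps elim!: eventually_mono\<close>)
      next
        case 5
        then show ?thesis
          by (intro *) (use \<epsilon>(1) in \<open>auto simp: test_fun_def step_le_0 field_simps elim!: eventually_mono\<close>)
      qed
    qed

    have sides: "((x1, t) \<notin> ?U \<and> (x2, t) \<notin> ?U) \<or> ((x1, t) \<in> ?U \<and> (x2, t) \<in> ?U \<and>
       ?\<zeta> (x1, t) * (\<mu> (x1, t) * X (x1, t)) = ?\<zeta> (x2, t) * (\<mu> (x2, t) * X (x2, t)))" for t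
    proof (cases b)
      case Line
      have "(x, t) \<notin> ?U" if "\<bar>x\<bar> \<ge> R" for x
      proof
        assume "(x, t) \<in> ?U"
        then have "norm (pt b (x, t)) < R" using R(2) by blast
        moreover have "\<bar>x\<bar> \<le> norm (pt b (x, t))"
          using norm_fst_le[of "complex_of_real x" t] by (simp add: pt_def Line)
        ultimately show False using that by simp
      qed
      then show ?thesis by (simp add: x1_def x2_def L_def Line)
    next
      case Circle
      \<comment> \<open>The two sides lie over the same points of the surface, and all functions
        involved are pulled back from there; their derivatives agree by
        \<open>frechet_derivative_translate\<close>.\<close>
      have x2: "(x2, t) = (x1, t) + (2 * pi, 0)"
        by (simp add: x1_def x2_def L_def Circle)
      have pt12: "pt b (x2, t) = pt b (x1, t)"
        unfolding x2 Circle by (rule pt_translate)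
      show ?thesis
      proof (cases "(x1, t) \<in> ?U")
        case False
        then show ?thesis using pt12 by simp
      next
        case True
        then have dif: "?v1 differentiable (at (x1, t))" "?v2 differentiable (at (x1, t))"
          using C1v by (auto simp only: C1_def)
        have "frechet_derivative ?v1 (at (x2, t)) = frechet_derivative ?v1 (at (x1, t))"
          "frechet_derivative ?v2 (at (x2, t)) = frechet_derivative ?v2 (at (x1, t))"
          unfolding x2 by (rule frechet_derivative_translate; use dif pt_translate Circle in simp)+
        moreover have "base_pt b x2 = base_pt b x1"
          using pt12 by (simp add: pt_def)
        ultimately have "X (x2, t) = X (x1, t)" "\<mu> (x2, t) = \<mu> (x1, t)"
          by (simp_all add: X_def flux_x_def slope_def weight_x_def weight_t_def mass_def)
        moreover have "?\<zeta> (x2, t) = ?\<zeta> (x1, t)"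
          using pt12 \<psi>(4)[OF pt12] by (simp add: test_fun_def)
        ultimately show ?thesis using True pt12 by simp
      qed
    qed
    have ends: "(x, - R) \<notin> ?U \<and> (x, R) \<notin> ?U" for x
      using Rt[of "(x, - R)"] Rt[of "(x, R)"] by auto
    have low: "?v2 p \<le> K \<and> ?v1 p \<ge> - K \<and> \<psi> p = 1 \<and> ?\<eta> \<le> G p" if "p \<in> cbox l h" for p
    proof -
      have p: "G p > ?\<eta>" "?v2 p < ?v2 p0 + 1" "?v1 p > ?v1 p0 - 1" "dist (pt b p0) (pt b p) < r / 2"
        using subsetD[OF lh(1) that] by auto
      have "dist (pt b p) v \<ge> r / 2" if "v \<in> V" for v
        using r(2)[OF that] p(4) dist_triangle[of "pt b p0" v "pt b p"] by linarith
      then show ?thesis using p K \<psi>(7)[of p] by auto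
    qed
    let ?err = "\<lambda>p. \<mu> p * (4 / K + 2 * (\<bar>\<alpha> p\<bar> * \<bar>frechet_derivative \<psi> (at p) (1, 0)\<bar> + \<bar>\<beta> p\<bar> * \<bar>frechet_derivative \<psi> (at p) (0, 1)\<bar>))"
    have "?\<eta> * m \<le> integral ?B ?err"
      unfolding m_def
    proof (rule energy_estimate[OF U C1_mass mass_pos \<alpha>\<beta> C1v C1f _ \<psi>(1-3) \<epsilon>(1) K(1) _ box _ ends])
      show "frechet_derivative (\<lambda>q. \<mu> q * flux_x \<alpha> \<beta> u q) (at p) (1, 0) +
          frechet_derivative (\<lambda>q. \<mu> q * flux_t \<alpha> \<beta> u q) (at p) (0, 1) = 0"
        if "p \<in> ?U" "u \<in> {?v1, ?v2}" for p u
        using solution_conservation[OF \<Omega>(1) sol(1) that(1)] solution_conservation[OF \<Omega>(1) sol(2) that(1)] that(2)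
        by blast
      show "cbox l h \<subseteq> ?U" using lh(1) by blast
      show "cbox l h \<subseteq> ?B" using lh(1) box_subset_cbox by blast
      show "0 \<le> ?\<eta>" using G0 by simp
      show "\<exists>N. open N \<and> p \<in> N \<and> (\<forall>q\<in>N \<inter> ?U. ?\<zeta> q = 0)" if "p \<notin> ?U" for p
        by (rule zero[OF that])
      show "?v2 p \<le> K \<and> ?v1 p \<ge> - K \<and> \<psi> p = 1 \<and> ?\<eta> \<le> \<mu> p * (step' ((?v1 p - ?v2 p) / \<epsilon> - 1) / \<epsilon> *
          ((flux_x \<alpha> \<beta> ?v1 p - flux_x \<alpha> \<beta> ?v2 p) * frechet_derivative ?v1 (at p) (1, 0) +
           (flux_t \<alpha> \<beta> ?v1 p - flux_t \<alpha> \<beta> ?v2 p) * frechet_derivative ?v1 (at p) (0, 1) -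
           ((flux_x \<alpha> \<beta> ?v1 p - flux_x \<alpha> \<beta> ?v2 p) * frechet_derivative ?v2 (at p) (1, 0) +
           (flux_t \<alpha> \<beta> ?v1 p - flux_t \<alpha> \<beta> ?v2 p) * frechet_derivative ?v2 (at p) (0, 1))))"
        if "p \<in> cbox l h" for p
        using low[OF that] unfolding G_def[THEN fun_cong, of p] E_def X_def Y_def .
    qed (use sides in \<open>simp only: X_def\<close>)
    also have "\<dots> \<le> integral ?B (\<lambda>p. M * (4 / K) + M * ?D p)"
    proof (rule integral_le)
      have cD: "continuous_on ?B (\<lambda>p. frechet_derivative \<psi> (at p) v)" for v
        by (rule continuous_on_subset[OF C1_continuous_deriv[OF \<psi>(1)] subset_UNIV])
      show "?err integrable_on ?B" "(\<lambda>p. M * (4 / K) + M * ?D p) integrable_on ?B"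
        by (intro integrable_continuous continuous_intros cD C1_continuous[OF C1_mass]
          continuous_on_subset[OF \<alpha>\<beta>(1) subset_UNIV] continuous_on_subset[OF \<alpha>\<beta>(2) subset_UNIV])+
      fix p assume p: "p \<in> ?B"
      have "?h p \<le> M" using M(2)[OF p] by simp
      moreover have "0 \<le> \<mu> p * \<bar>\<alpha> p\<bar>" "0 \<le> \<mu> p * \<bar>\<beta> p\<bar>" "0 \<le> \<mu> p"
        using mass_pos[of p] by auto
      moreover have "?h p = \<mu> p + 2 * (\<mu> p * \<bar>\<alpha> p\<bar>) + 2 * (\<mu> p * \<bar>\<beta> p\<bar>)"
        by (simp add: algebra_simps)
      ultimately have le: "\<mu> p \<le> M" "2 * (\<mu> p * \<bar>\<alpha> p\<bar>) \<le> M" "2 * (\<mu> p * \<bar>\<beta> p\<bar>) \<le> M"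
        by linarith+
      have "?err p = \<mu> p * (4 / K) + (2 * (\<mu> p * \<bar>\<alpha> p\<bar>) * \<bar>frechet_derivative \<psi> (at p) (1, 0)\<bar>
          + 2 * (\<mu> p * \<bar>\<beta> p\<bar>) * \<bar>frechet_derivative \<psi> (at p) (0, 1)\<bar>)"
        by (simp add: algebra_simps)
      also have "\<dots> \<le> M * (4 / K) + (M * \<bar>frechet_derivative \<psi> (at p) (1, 0)\<bar> + M * \<bar>frechet_derivative \<psi> (at p) (0, 1)\<bar>)"
        using le K(1) by (intro add_mono mult_right_mono) auto
      finally show "?err p \<le> M * (4 / K) + M * ?D p" by (simp add: distrib_left)
    qed
    also have "\<dots> = M * (4 / K) * A + M * integral ?B ?D"
    proof -
      have cD: "continuous_on ?B (\<lambda>p. frechet_derivative \<psi> (at p) v)" for v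
        by (rule continuous_on_subset[OF C1_continuous_deriv[OF \<psi>(1)] subset_UNIV])
      have "integral ?B (\<lambda>p. M * (4 / K) + M * ?D p) = integral ?B (\<lambda>p. M * (4 / K)) + integral ?B (\<lambda>p. M * ?D p)"
        by (intro integral_add integrable_continuous continuous_intros cD)
      moreover have "integral ?B (\<lambda>p. M * (4 / K)) = M * (4 / K) * A"
        unfolding A_def by (subst integral_const) simp
      moreover have "integral ?B (\<lambda>p. M * ?D p) = M * integral ?B ?D"
        by (rule integral_mult_right)
      ultimately show ?thesis by simp
    qed
    also have "\<dots> \<le> ?\<eta> * m / 4 + M * e"
    proof (rule add_mono)
      have "16 * M * A \<le> K * (?\<eta> * m)"
        using K(4) \<eta>m by (simp add: pos_divide_le_eq)
      then show "M * (4 / K) * A \<le> ?\<eta> * m / 4"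
        using K(1) by (simp add: pos_divide_le_eq mult.commute mult.left_commute)
      show "M * integral ?B ?D \<le> M * e"
        using \<psi>(8) M(1) by (intro mult_left_mono) auto
    qed
    also have "\<dots> = ?\<eta> * m / 2" using M(1) by (simp add: e_def)
    finally show False using \<eta>m by linarith
  qed
  ultimately have "E ?v1 p0 - E ?v2 p0 = 0" by fastforce
  moreover have "\<alpha> p0 \<noteq> 0" "\<beta> p0 \<noteq> 0"
    using \<rho>_pos[OF base_pt_in[of b "fst p0"]] \<phi>_base_nz[of "fst p0"] by (auto simp: weight_x_def weight_t_def)
  ultimately have eq: "frechet_derivative ?v1 (at p0) (1, 0) = frechet_derivative ?v2 (at p0) (1, 0)"
    "frechet_derivative ?v1 (at p0) (0, 1) = frechet_derivative ?v2 (at p0) (0, 1)"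
    using gradients.pairing_diff_eq_0D[of \<alpha> \<beta> ?v1 p0 ?v2] unfolding E_def X_def Y_def by blast+
  have d: "?v1 differentiable (at p0)" "?v2 differentiable (at p0)"
    using C1v p0U by (simp_all only: C1_def)
  show ?thesis
    unfolding frechet_derivative_prod[OF d(1), of v] frechet_derivative_prod[OF d(2), of v] eq ..
qed

end

section \<open>Openness of the coordinate map, and constancy on connected domains\<close>

lemma pt_local_section:
  obtains s where "isCont s (pt b p)" "s (pt b p) = p" "\<And>P. P \<in> surf b \<Longrightarrow> pt b (s P) = P"
proof (cases b)
  case Line
  let ?s = "\<lambda>P :: complex \<times> real. (Re (fst P), snd P)"
  have "isCont ?s (pt b p)" by (intro isCont_Pair Complex.isCont_Re continuous_intros)
  then show ?thesis
    by (rule that) (auto simp: Line pt_def surf_def base_set_def)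
next
  case Circle
  let ?w = "cis (fst p)"
  \<comment> \<open>Dividing by the base point before taking \<open>Arg\<close> moves the branch cut
    to its antipode, so this section is continuous at the point in question.\<close>
  let ?s = "\<lambda>P. (fst p + Arg (fst P / ?w), snd P)"
  have "isCont (\<lambda>P. Arg (fst P / ?w)) (pt b p)"
  proof (rule isCont_o2[where g = Arg])
    show "isCont (\<lambda>P. fst P / ?w) (pt b p)" by (intro continuous_intros) simp
    show "isCont Arg (fst (pt b p) / ?w)"
      by (rule continuous_at_Arg) (simp add: pt_def Circle)
  qed
  then have "isCont ?s (pt b p)" by (intro continuous_intros)
  then show ?thesis
  proof (rule that)
    show "?s (pt b p) = p" by (simp add: pt_def Circle)
    fix P assume "P \<in> surf b"
    then obtain x where x: "fst P = cis x" by (auto simp: surf_def base_set_def Circle)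
    have "cis (Arg (cis x / ?w)) = cis x / ?w"
      by (subst cis_Arg) (auto simp: sgn_div_norm norm_divide)
    then show "pt b (?s P) = P"
      by (simp add: pt_def Circle x prod_eq_iff flip: cis_mult)
  qed
qed

text \<open>A section that is continuous at the single point \<open>P\<close> sends a neighbourhood
  of \<open>P\<close> into \<open>N\<close>, so this neighbourhood lies in the image. Openness
  carries open level sets from the plane down to the surface.\<close>

lemma pt_open_map:
  assumes "open N"
  shows "openin (top_of_set (surf b)) (pt b ` N)"
proof (subst openin_subopen, intro ballI)
  fix P assume "P \<in> pt b ` N"
  then obtain p where p: "p \<in> N" "P = pt b p" by blast
  obtain s where s: "isCont s (pt b p)" "s (pt b p) = p" "\<And>P. P \<in> surf b \<Longrightarrow> pt b (s P) = P"
    by (rule pt_local_section[where b = b and p = p]) blast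
  obtain T where T: "open T" "P \<in> T" "\<And>Q. Q \<in> T \<Longrightarrow> s Q \<in> N"
    using s(1)[unfolded continuous_at_open, rule_format, of N] s(2) p assms by auto
  have "surf b \<inter> T \<subseteq> pt b ` N"
  proof
    fix Q assume Q: "Q \<in> surf b \<inter> T"
    then have "pt b (s Q) = Q" by (intro s(3)) simp
    then show "Q \<in> pt b ` N" using T(3)[of Q] Q by (intro image_eqI[of _ _ "s Q"]) auto
  qed
  then show "\<exists>T. openin (top_of_set (surf b)) T \<and> P \<in> T \<and> T \<subseteq> pt b ` N"
    using T(1,2) p(2) pt_in_surf by (intro exI[of _ "surf b \<inter> T"]) (auto simp: openin_open_Int)
qed

text \<open>The derivative is known to vanish only where \<open>w > 0\<close>. The level set of the
  positive value \<open>w P\<close> is still open, because around each of its points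
  \<open>w\<close> is positive on a ball and hence constant there; its complement is open by
  continuity. Connectedness then excludes nonpositive values as well.\<close>

lemma connected_locally_constant:
  assumes \<Omega>: "openin (top_of_set (surf b)) \<Omega>" "connected \<Omega>" and w: "C1 (w \<circ> pt b) (pt b -` \<Omega>)"
    and crit: "\<And>p h. p \<in> pt b -` \<Omega> \<Longrightarrow> w (pt b p) > 0 \<Longrightarrow> frechet_derivative (w \<circ> pt b) (at p) h = 0"
    and P: "P \<in> \<Omega>" "w P > (0 :: real)" and Q: "Q \<in> \<Omega>"
  shows "w Q = w P"
proof (rule ccontr)
  assume ne: "w Q \<noteq> w P"
  let ?U = "pt b -` \<Omega>" and ?v = "w \<circ> pt b"
  have U: "open ?U" by (rule open_pt_vimage[OF \<Omega>(1)])
  have v: "continuous_on ?U ?v" by (rule C1_continuous[OF w])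
  have img: "pt b ` (?U \<inter> ?v -` T) = {R \<in> \<Omega>. w R \<in> T}" for T
  proof
    show "{R \<in> \<Omega>. w R \<in> T} \<subseteq> pt b ` (?U \<inter> ?v -` T)"
    proof
      fix R assume R: "R \<in> {R \<in> \<Omega>. w R \<in> T}"
      then obtain r where "pt b r = R"
        using surf_pt[of R b] openin_imp_subset[OF \<Omega>(1)] by blast
      then show "R \<in> pt b ` (?U \<inter> ?v -` T)" using R by force
    qed
  qed auto
  have "open (?U \<inter> ?v -` {w P})"
  proof (subst open_subopen, intro ballI)
    fix p assume p: "p \<in> ?U \<inter> ?v -` {w P}"
    have "open (?U \<inter> ?v -` {0<..})"
      by (intro continuous_open_preimage v U open_greaterThan)
    moreover have "p \<in> ?U \<inter> ?v -` {0<..}" using p P by auto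
    ultimately obtain e where e: "e > 0" "ball p e \<subseteq> ?U \<inter> ?v -` {0<..}"
      by (meson open_contains_ball)
    have eq: "?v q = ?v p" if "q \<in> ball p e" for q
    proof (rule has_derivative_zero_unique[OF convex_ball _ that])
      fix r assume "r \<in> ball p e"
      then have r: "r \<in> ?U" "w (pt b r) > 0" using e(2) by auto
      have "frechet_derivative ?v (at r) = (\<lambda>h. 0)"
        using crit[OF r] by blast
      then show "(?v has_derivative (\<lambda>h. 0)) (at r within ball p e)"
        using C1_has_derivative[OF w r(1)] by (auto intro: has_derivative_at_withinI)
    qed (use e in auto)
    have "?v q \<in> {w P}" if "q \<in> ball p e" for q
      using eq[OF that] p by simp
    then have "ball p e \<subseteq> ?U \<inter> ?v -` {w P}" using e(2) by blast
    then show "\<exists>T. open T \<and> p \<in> T \<and> T \<subseteq> ?U \<inter> ?v -` {w P}"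
      using e(1) by (intro exI[of _ "ball p e"]) auto
  qed
  from pt_open_map[OF this, of b] have 1: "openin (top_of_set \<Omega>) {R \<in> \<Omega>. w R \<in> {w P}}"
    unfolding img by (rule openin_subset_trans[OF _ _ openin_imp_subset[OF \<Omega>(1)]]) blast
  have "open (?U \<inter> ?v -` (- {w P}))"
    by (intro continuous_open_preimage v U) auto
  from pt_open_map[OF this, of b] have 2: "openin (top_of_set \<Omega>) {R \<in> \<Omega>. w R \<in> - {w P}}"
    unfolding img by (rule openin_subset_trans[OF _ _ openin_imp_subset[OF \<Omega>(1)]]) blast
  have "{R \<in> \<Omega>. w R \<in> {w P}} \<noteq> {}" "{R \<in> \<Omega>. w R \<in> - {w P}} \<noteq> {}"
    using P(1) Q ne by blast+
  moreover have "\<Omega> \<subseteq> {R \<in> \<Omega>. w R \<in> {w P}} \<union> {R \<in> \<Omega>. w R \<in> - {w P}}"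
    "{R \<in> \<Omega>. w R \<in> {w P}} \<inter> {R \<in> \<Omega>. w R \<in> - {w P}} = {}" by auto
  ultimately show False
    using \<Omega>(2) 1 2 unfolding connected_openin by blast
qed

lemma (in weights) comparison:
  assumes \<rho>_pos: "\<And>z. z \<in> base_set b \<Longrightarrow> \<rho> z > 0"
    and \<Omega>: "openin (top_of_set (surf b)) \<Omega>" "bounded \<Omega>" "connected \<Omega>"
    and sol: "is_solution b c \<phi> \<rho> \<Omega> u1" "is_solution b c \<phi> \<rho> \<Omega> u2"
    and V: "finite V" "V \<inter> \<Omega> = {}"
    and bdry: "\<And>P. P \<in> surf b \<Longrightarrow> P \<in> closure \<Omega> \<Longrightarrow> P \<notin> \<Omega> \<Longrightarrow> P \<notin> V \<Longrightarrow>
      filterlim u2 at_top (at P within \<Omega>) \<or> filterlim u1 at_bot (at P within \<Omega>) \<or>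
      (\<forall>e>0. \<forall>\<^sub>F Q in at P within \<Omega>. u1 Q - u2 Q < e)"
    and P: "P \<in> \<Omega>" "u1 P > u2 P" and Q: "Q \<in> \<Omega>"
  shows "u1 Q - u2 Q = u1 P - u2 P"
proof (rule connected_locally_constant[OF \<Omega>(1,3), where w = "\<lambda>P. u1 P - u2 P"])
  note C = solution_C1(1)[OF sol(1)] solution_C1(1)[OF sol(2)]
  have w: "(\<lambda>P. u1 P - u2 P) \<circ> pt b = (\<lambda>p. (u1 \<circ> pt b) p - (u2 \<circ> pt b) p)" by (simp add: o_def)
  show "C1 ((\<lambda>P. u1 P - u2 P) \<circ> pt b) (pt b -` \<Omega>)"
    unfolding w by (rule C1_diff[OF C])
  fix p h assume p: "p \<in> pt b -` \<Omega>" "u1 (pt b p) - u2 (pt b p) > 0"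
  have "frechet_derivative ((\<lambda>P. u1 P - u2 P) \<circ> pt b) (at p) h =
    frechet_derivative (u1 \<circ> pt b) (at p) h - frechet_derivative (u2 \<circ> pt b) (at p) h"
    unfolding w by (rule frechet_derivative_diff) (use C p(1) in \<open>simp_all only: C1_def\<close>)
  also have "\<dots> = 0"
    using gradients_agree[OF \<rho>_pos \<Omega>(1,2) sol V bdry, of p h] p by simp
  finally show "frechet_derivative ((\<lambda>P. u1 P - u2 P) \<circ> pt b) (at p) h = 0" .
qed (use P Q in auto)

section \<open>Adding constants to solutions, and boundary values\<close>

lemma frechet_derivative_add_const:
  "frechet_derivative (\<lambda>p. f p + k) F = frechet_derivative f F" for f :: "'a::real_normed_vector \<Rightarrow> 'b::real_normed_vector"
proof -
  \<comment> \<open>Both functions admit the same candidates, so the choice in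
    \<open>frechet_derivative\<close> coincides even where neither is differentiable.\<close>
  have "((\<lambda>p. f p + k) has_derivative f') F \<longleftrightarrow> (f has_derivative f') F" for f'
    using has_derivative_add_const[of "\<lambda>p. f p + k" f' F "- k"] has_derivative_add_const[of f f' F k] by auto
  then show ?thesis by (simp add: frechet_derivative_def)
qed

lemma C_on_add_const: "C_on n f U \<Longrightarrow> C_on n (\<lambda>p. f p + k) U"
  by (cases n) (auto simp: frechet_derivative_add_const intro: continuous_on_add continuous_on_const)

text \<open>Only derivatives of \<open>u\<close> enter the equation. The shift serves to make the
  difference of two solutions positive at a chosen point.\<close>

lemma is_solution_add_const:
  assumes "is_solution b c \<phi> \<rho> \<Omega> u"
  shows "is_solution b c \<phi> \<rho> \<Omega> (\<lambda>P. u P + k)"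
proof -
  have o: "(\<lambda>P. u P + k) \<circ> pt b = (\<lambda>p. (u \<circ> pt b) p + k)" by (simp add: o_def)
  note C = C_on_add_const[of _ "u \<circ> pt b" "pt b -` \<Omega>" k]
  have g: "grad G (\<lambda>p. (u \<circ> pt b) p + k) = grad G (u \<circ> pt b)" for G
    unfolding grad_def[abs_def] frechet_derivative_add_const ..
  have W: "Wfun b c \<phi> \<rho> (\<lambda>p. (u \<circ> pt b) p + k) = Wfun b c \<phi> \<rho> (u \<circ> pt b)"
    unfolding Wfun_def g ..
  show ?thesis
    using assms C unfolding is_solution_def smooth_def o g W by blast
qed

lemma frontier_in_surf:
  assumes "openin (top_of_set (surf b)) \<Omega>"
  shows "top_of_set (surf b) frontier_of \<Omega> = surf b \<inter> closure \<Omega> - \<Omega>"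
proof -
  have "surf b \<inter> \<Omega> = \<Omega>" using openin_imp_subset[OF assms] by blast
  then show ?thesis
    by (simp add: frontier_of_def closure_of_subtopology interior_of_openin[OF assms])
qed

lemma boundary_value_tendsto:
  assumes "extends_continuously_to u \<Omega> E" "P \<in> E" "P islimpt \<Omega>"
  shows "(u \<longlongrightarrow> boundary_value u \<Omega> P) (at P within \<Omega>)"
proof -
  obtain v where v: "continuous_on (\<Omega> \<union> E) v" "\<And>Q. Q \<in> \<Omega> \<Longrightarrow> v Q = u Q"
    using assms(1) by (auto simp: extends_continuously_to_def)
  have "(v \<longlongrightarrow> v P) (at P within \<Omega> \<union> E)"
    using v(1) assms(2) by (auto simp: continuous_on_def)
  then have "(v \<longlongrightarrow> v P) (at P within \<Omega>)"
    by (rule tendsto_within_subset) auto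
  then have lim: "(u \<longlongrightarrow> v P) (at P within \<Omega>)"
    by (rule Lim_transform_eventually) (auto simp: eventually_at_filter v(2))
  \<comment> \<open>At a limit point of \<open>\<Omega>\<close> limits are unique, so the
    description in \<open>Lim\<close> denotes the value of the extension.\<close>
  moreover have "boundary_value u \<Omega> P = v P"
    unfolding boundary_value_def using assms(3) lim by (intro tendsto_Lim) (auto simp: trivial_limit_within)
  ultimately show ?thesis by simp
qed

text \<open>The shift \<open>k\<close> serves both halves of the theorem: it is 0 when boundary
  values on the arcs \<open>\<C>\<close> agree, and makes the difference positive when there are no
  such arcs. The end points of the arcs form the exceptional set \<open>V\<close>. On an arc of
  \<open>\<C>\<close> the shifted difference would tend to 0 while being a positive constant, so no
  such arc exists.\<close>

lemma jenkins_serrin_comparison: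
  assumes "smooth_on_base b \<phi>" "\<forall>z\<in>base_set b. \<phi> z \<noteq> 0" "smooth_on_base b \<rho>" "\<forall>z\<in>base_set b. \<rho> z > 0"
    and adm: "admissible_domain b c \<phi> \<rho> \<Omega> \<A> \<B> \<C>"
    and js: "jenkins_serrin_solution b c \<phi> \<rho> \<Omega> \<A> \<B> \<C> u1" "jenkins_serrin_solution b c \<phi> \<rho> \<Omega> \<A> \<B> \<C> u2"
    and bv: "\<forall>\<gamma>\<in>\<C>. \<forall>p\<in>open_arc b \<gamma>. boundary_value u1 \<Omega> p + k = boundary_value u2 \<Omega> p"
    and P: "P \<in> \<Omega>" "u1 P + k > u2 P" and Q: "Q \<in> \<Omega>"
  shows "u1 Q - u2 Q = u1 P - u2 P" and "\<C> = {}"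
proof -
  interpret weights b c \<phi> \<rho>
    by unfold_locales (use assms in auto)
  have \<Omega>: "openin (top_of_set (surf b)) \<Omega>" "connected \<Omega>" "bounded \<Omega>"
    using adm bounded_subset[OF compact_imp_bounded closure_subset] by (auto simp: admissible_domain_def)
  have fr: "surf b \<inter> closure \<Omega> - \<Omega> = (\<Union>\<gamma>\<in>\<A> \<union> \<B> \<union> \<C>. open_arc b \<gamma> \<union> arc_ends b \<gamma>)"
    using adm frontier_in_surf[OF \<Omega>(1)] by (simp add: admissible_domain_def)
  define V where "V = (\<Union>\<gamma>\<in>\<A> \<union> \<B> \<union> \<C>. arc_ends b \<gamma>)"
  have V: "finite V" "V \<inter> \<Omega> = {}"
    using adm fr by (auto simp: V_def admissible_domain_def arc_ends_def)
  have lim: "((\<lambda>Q. u1 Q + k - u2 Q) \<longlongrightarrow> 0) (at R within \<Omega>)" if \<gamma>: "\<gamma> \<in> \<C>" "R \<in> open_arc b \<gamma>" for \<gamma> R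
  proof -
    have "R islimpt \<Omega>"
      using \<gamma> fr by (intro islimpt_boundary) auto
    then have "(u1 \<longlongrightarrow> boundary_value u1 \<Omega> R) (at R within \<Omega>)" "(u2 \<longlongrightarrow> boundary_value u2 \<Omega> R) (at R within \<Omega>)"
      using js \<gamma> by (auto intro!: boundary_value_tendsto simp: jenkins_serrin_solution_def)
    then have "((\<lambda>Q. u1 Q + k - u2 Q) \<longlongrightarrow> boundary_value u1 \<Omega> R + k - boundary_value u2 \<Omega> R) (at R within \<Omega>)"
      by (intro tendsto_intros)
    then show ?thesis using bv \<gamma> by simp
  qed
  have const: "u1 R + k - u2 R = u1 P + k - u2 P" if "R \<in> \<Omega>" for R
  proof (rule comparison[OF _ \<Omega>(1,3,2) _ _ V])
    show "is_solution b c \<phi> \<rho> \<Omega> (\<lambda>P. u1 P + k)" "is_solution b c \<phi> \<rho> \<Omega> u2"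
      using js by (auto simp: jenkins_serrin_solution_def intro: is_solution_add_const)
    fix R assume "R \<in> surf b" "R \<in> closure \<Omega>" "R \<notin> \<Omega>" "R \<notin> V"
    then have "R \<in> (\<Union>\<gamma>\<in>\<A> \<union> \<B> \<union> \<C>. open_arc b \<gamma>)"
      using fr unfolding V_def by blast
    then consider \<gamma> where "\<gamma> \<in> \<A>" "R \<in> open_arc b \<gamma>" | \<gamma> where "\<gamma> \<in> \<B>" "R \<in> open_arc b \<gamma>"
      | \<gamma> where "\<gamma> \<in> \<C>" "R \<in> open_arc b \<gamma>" by blast
    then show "filterlim u2 at_top (at R within \<Omega>) \<or> filterlim (\<lambda>P. u1 P + k) at_bot (at R within \<Omega>) \<or>
      (\<forall>e>0. \<forall>\<^sub>F Q in at R within \<Omega>. u1 Q + k - u2 Q < e)"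
    proof cases
      case 1
      then show ?thesis using js(2) by (auto simp: jenkins_serrin_solution_def)
    next
      case 2
      then have "filterlim u1 at_bot (at R within \<Omega>)"
        using js(1) by (auto simp: jenkins_serrin_solution_def)
      then have "\<forall>\<^sub>F P in at R within \<Omega>. u1 P \<le> Z - k" for Z
        by (simp add: filterlim_at_bot)
      then show ?thesis by (simp add: filterlim_at_bot algebra_simps)
    next
      case 3
      from order_tendstoD(2)[OF lim[OF this]] show ?thesis by blast
    qed
  qed (use assms that in auto)
  show "u1 Q - u2 Q = u1 P - u2 P" using const[OF Q] by simp
  show "\<C> = {}"
  proof (rule ccontr)
    assume "\<C> \<noteq> {}"
    then obtain \<gamma> where \<gamma>: "\<gamma> \<in> \<C>" by blast
    let ?R = "pt b (\<gamma> (1 / 2))"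
    have R: "?R \<in> open_arc b \<gamma>"
      unfolding open_arc_def by (rule image_eqI[where x = "1 / 2"]) auto
    have "?R islimpt \<Omega>"
      using \<gamma> R fr by (intro islimpt_boundary) auto
    moreover have "((\<lambda>Q. u1 Q + k - u2 Q) \<longlongrightarrow> u1 P + k - u2 P) (at ?R within \<Omega>)"
    proof (rule tendsto_eventually)
      show "\<forall>\<^sub>F Q in at ?R within \<Omega>. u1 Q + k - u2 Q = u1 P + k - u2 P"
        unfolding eventually_at_filter by (rule always_eventually) (use const in blast)
    qed
    ultimately have "u1 P + k - u2 P = 0"
      using tendsto_unique[OF _ _ lim[OF \<gamma> R]] unfolding trivial_limit_within by blast
    then show False using P(2) by simp
  qed
qed

theorem theorem4p2:
  fixes b :: base_curve and c :: real and \<phi> \<rho> :: "complex \<Rightarrow> real"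
    and \<Omega> :: "(complex \<times> real) set"
    and \<A> \<B> \<C> :: "(real \<Rightarrow> real \<times> real) set"
    and u1 u2 :: "complex \<times> real \<Rightarrow> real"
  assumes "smooth_on_base b \<phi>" and "\<forall>z\<in>base_set b. \<phi> z \<noteq> 0"
    and "smooth_on_base b \<rho>" and "\<forall>z\<in>base_set b. \<rho> z > 0"
    and "complete_riem b (warped_metric b \<phi> \<rho>)"
    and "admissible_domain b c \<phi> \<rho> \<Omega> \<A> \<B> \<C>"
    and "jenkins_serrin_solution b c \<phi> \<rho> \<Omega> \<A> \<B> \<C> u1"
    and "jenkins_serrin_solution b c \<phi> \<rho> \<Omega> \<A> \<B> \<C> u2"
  shows "(\<C> \<noteq> {} \<and>
            (\<forall>\<gamma>\<in>\<C>. \<forall>p\<in>open_arc b \<gamma>. boundary_value u1 \<Omega> p = boundary_value u2 \<Omega> p)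
          \<longrightarrow> (\<forall>p\<in>\<Omega>. u1 p = u2 p)) \<and>
         (\<C> = {} \<longrightarrow> (\<exists>k. \<forall>p\<in>\<Omega>. u2 p - u1 p = k))"
proof (intro conjI impI ballI)
  fix P assume C: "\<C> \<noteq> {} \<and>
      (\<forall>\<gamma>\<in>\<C>. \<forall>p\<in>open_arc b \<gamma>. boundary_value u1 \<Omega> p = boundary_value u2 \<Omega> p)" and P: "P \<in> \<Omega>"
  \<comment> \<open>A strict inequality in either direction, at any point, would force
    \<open>\<C> = {}\<close>.\<close>
  have "\<not> u1 P > u2 P"
    using jenkins_serrin_comparison(2)[OF assms(1-4,6-8), of 0 P P] C P by auto
  moreover have "\<not> u2 P > u1 P"
    using jenkins_serrin_comparison(2)[OF assms(1-4,6,8,7), of 0 P P] C P by auto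
  ultimately show "u1 P = u2 P" by simp
next
  assume C: "\<C> = {}"
  obtain P where P: "P \<in> \<Omega>"
    using assms(6) by (auto simp: admissible_domain_def)
  \<comment> \<open>The shift makes the difference equal to 1 at \<open>P\<close>; with
    \<open>\<C> = {}\<close> the condition on boundary values holds trivially.\<close>
  have "u2 Q - u1 Q = u2 P - u1 P" if "Q \<in> \<Omega>" for Q
    using jenkins_serrin_comparison(1)[OF assms(1-4,6-8), of "u2 P - u1 P + 1" P Q] C P that by simp
  then show "\<exists>k. \<forall>p\<in>\<Omega>. u2 p - u1 p = k" by blast
qed

end
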